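(* Let $\mathcal U\subset\mathbb R^n\times\mathbb R^n$ be open, $I\subset\mathbb R$ an open interval ($I=\mathbb R$ or $I=(0,\infty)$), and let the generating function $G:\mathcal U\times I\to\mathbb R$, with $G_z<0$, satisfy conditions G1, G2 and G1*. Let $A=A(x,u,p)$ and $A^*=A^*(y,z,q)$ be the matrix functions defined in the context. Then condition G3 holds if and only if condition G3* holds, and condition G3w holds if and only if condition G3*w holds, where: G3 (respectively G3w): $\sum D_{p_kp_l}A_{ij}\,\xi_i\xi_j\eta_k\eta_l>0$ (respectively $\ge0$) at every point $(x,u,p)\in\Gamma'$ and for all nonzero $\xi,\eta\in\mathbb R^n$ with $\xi\cdot\eta=0$; G3* (respectively G3*w): $\sum D_{q_iq_j}A^*_{kl}\,\xi_i\xi_j\eta_k\eta_l>0$ (respectively $\ge0$) at every point $(y,z,q)$ of the domain of $A^*$ and for all nonzero $\xi,\eta\in\mathbb R^n$ with $\xi\cdot\eta=0$.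
   Context: Notation. $G=G(x,y,z)$ is smooth on $\mathcal U\times I$ (with $(x,y)\in\mathcal U$, $z\in I$) and $G_z<0$. $\mathcal U^*_x=\{y:(x,y)\in\mathcal U\}$, $\mathcal U_y=\{x:(x,y)\in\mathcal U\}$, $\mathcal U^{(1)}=\bigcup_y\mathcal U_y$, $\mathcal U^{(2)}=\bigcup_x\mathcal U^*_x$. G1: for each $(x,y)\in\mathcal U$ there is an open interval $I(x,y)\subset I$ such that for each $x\in\mathcal U^{(1)}$ the map $(y,z)\mapsto (G_x(x,y,z),G(x,y,z))$ is one-to-one on $\{(y,z):y\in\mathcal U^*_x,\ z\in I(x,y)\}$. Put $\Gamma=\{(x,y,z):(x,y)\in\mathcal U,\ z\in I(x,y)\}$. G2: $\det E\neq0$ on $\Gamma$, where $E_{i,j}=G_{x_iy_j}-(G_z)^{-1}G_{x_iz}G_{y_j}$. G1*: with $Q=-G_y/G_z$, for each $y\in\mathcal U^{(2)}$ and each $z$, the map $x\mapsto Q(x,y,z)$ is one-to-one on $\{x:(x,y,z)\in\Gamma\}$. (The Jacobian matrix of $x\mapsto Q$ is $-E/G_z$ up to transposition, hence invertible.) Definition of $A$. $\Gamma'=\{(x,u,p): u=G(x,y,z),\ p=G_x(x,y,z)\text{ for some }(x,y,z)\in\Gamma\}$. For $(x,u,p)\in\Gamma'$, $(Y,Z)(x,u,p)$ is the unique $(y,z)$ with $(x,y,z)\in\Gamma$, $G_x(x,y,z)=p$, $G(x,y,z)=u$; and $A_{ij}(x,u,p)=G_{x_ix_j}(x,Y(x,u,p),Z(x,u,p))$.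 The $p$-derivatives are taken with $x,u$ fixed. Definition of $A^*$. The domain of $A^*$ is the set of $(y,z,q)$ such that $q=Q(x,y,z)$ for some $x$ with $(x,y,z)\in\Gamma$; this $x$ is unique and denoted $X(y,z,q)$. Then $$A^*_{kl}(y,z,q)=-\Big[\partial_{y_l}\Big(\frac{G_{y_k}}{G_z}\Big)+\partial_z\Big(\frac{G_{y_k}}{G_z}\Big)q_l\Big](X(y,z,q),y,z),$$ equivalently $A^*_{kl}=H_{y_ky_l}(X,y,u)$ with $u=G(X,y,z)$, where $H$ is defined by $G(x,y,H(x,y,u))=u$. The $q$-derivatives are taken with $y,z$ fixed. Derivatives of $Y,Z,A$ (and of $X,A^*$) at a given point are those of the smooth local inverses given by the inverse function theorem (using $G_z\det E\neq0$). *)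

theory Defs
  imports "HOL-Analysis.Analysis"
begin

subsection \<open>Smoothness and partial derivatives\<close>

text \<open>Both notions are meant for open \<open>S\<close>: the derivatives are taken \<open>at x\<close>, not \<open>at x within S\<close>.\<close>

primrec Ck_on :: "nat \<Rightarrow> ('a::real_normed_vector \<Rightarrow> 'b::real_normed_vector) \<Rightarrow> 'a set \<Rightarrow> bool" where
  "Ck_on 0 f S \<longleftrightarrow> continuous_on S f"
| "Ck_on (Suc k) f S \<longleftrightarrow>
     (\<forall>x\<in>S. f differentiable (at x)) \<and>
     (\<forall>v. Ck_on k (\<lambda>x. frechet_derivative f (at x) v) S)"

definition smooth_on :: "('a::real_normed_vector \<Rightarrow> 'b::real_normed_vector) \<Rightarrow> 'a set \<Rightarrow> bool" where
  "smooth_on f S \<longleftrightarrow> (\<forall>k. Ck_on k f S)"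

definition pd :: "'n \<Rightarrow> (real ^ 'n \<Rightarrow> real) \<Rightarrow> real ^ 'n \<Rightarrow> real" where
  "pd i f a = deriv (\<lambda>t. f (a + t *\<^sub>R axis i 1)) 0"

definition pd2 :: "'n \<Rightarrow> 'n \<Rightarrow> (real ^ 'n \<Rightarrow> real) \<Rightarrow> real ^ 'n \<Rightarrow> real" where
  "pd2 i j f = pd j (pd i f)"

subsection \<open>Derivatives of the generating function\<close>

type_synonym 'n genfun = "real ^ 'n \<Rightarrow> real ^ 'n \<Rightarrow> real \<Rightarrow> real"

definition Gx :: "'n genfun \<Rightarrow> real ^ 'n \<Rightarrow> real ^ 'n \<Rightarrow> real \<Rightarrow> real ^ 'n" where
  "Gx G x y z = (\<chi> i. pd i (\<lambda>x'. G x' y z) x)"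

definition Gy :: "'n genfun \<Rightarrow> real ^ 'n \<Rightarrow> real ^ 'n \<Rightarrow> real \<Rightarrow> real ^ 'n" where
  "Gy G x y z = (\<chi> k. pd k (\<lambda>y'. G x y' z) y)"

definition Gz :: "'n genfun \<Rightarrow> real ^ 'n \<Rightarrow> real ^ 'n \<Rightarrow> real \<Rightarrow> real" where
  "Gz G x y z = deriv (\<lambda>z'. G x y z') z"

definition Gxx :: "'n genfun \<Rightarrow> real ^ 'n \<Rightarrow> real ^ 'n \<Rightarrow> real \<Rightarrow> real ^ 'n ^ 'n" where
  "Gxx G x y z = (\<chi> i j. pd2 i j (\<lambda>x'. G x' y z) x)"

definition E_mat :: "'n genfun \<Rightarrow> real ^ 'n \<Rightarrow> real ^ 'n \<Rightarrow> real \<Rightarrow> real ^ 'n ^ 'n" where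
  "E_mat G x y z = (\<chi> i j.
     pd j (\<lambda>y'. Gx G x y' z $ i) y
     - inverse (Gz G x y z) * deriv (\<lambda>z'. Gx G x y z' $ i) z * Gy G x y z $ j)"

definition Q_map :: "'n genfun \<Rightarrow> real ^ 'n \<Rightarrow> real ^ 'n \<Rightarrow> real \<Rightarrow> real ^ 'n" where
  "Q_map G x y z = (\<chi> k. - (Gy G x y z $ k) / Gz G x y z)"

subsection \<open>The conditions on the generating function\<close>

text \<open>Throughout, \<open>J x y\<close> is the interval $I(x,y)$ of condition G1.\<close>

definition fibre2 :: "((real ^ 'n) \<times> (real ^ 'n)) set \<Rightarrow> real ^ 'n \<Rightarrow> (real ^ 'n) set" where
  "fibre2 U x = {y. (x, y) \<in> U}"

definition proj1 :: "((real ^ 'n) \<times> (real ^ 'n)) set \<Rightarrow> (real ^ 'n) set" where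
  "proj1 U = (\<Union>y. {x. (x, y) \<in> U})"

definition proj2 :: "((real ^ 'n) \<times> (real ^ 'n)) set \<Rightarrow> (real ^ 'n) set" where
  "proj2 U = (\<Union>x. fibre2 U x)"

definition Gamma_set ::
  "((real ^ 'n) \<times> (real ^ 'n)) set \<Rightarrow> (real ^ 'n \<Rightarrow> real ^ 'n \<Rightarrow> real set) \<Rightarrow> ((real ^ 'n) \<times> (real ^ 'n) \<times> real) set" where
  "Gamma_set U J = {(x, y, z). (x, y) \<in> U \<and> z \<in> J x y}"

definition cond_G1 where
  "cond_G1 G U I J \<longleftrightarrow>
     (\<forall>x y. (x, y) \<in> U \<longrightarrow> open (J x y) \<and> is_interval (J x y) \<and> J x y \<noteq> {} \<and> J x y \<subseteq> I) \<and>
     (\<forall>x\<in>proj1 U. inj_on (\<lambda>(y, z). (Gx G x y z, G x y z)) {(y, z). y \<in> fibre2 U x \<and> z \<in> J x y})"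

definition cond_G2 where
  "cond_G2 G U J \<longleftrightarrow> (\<forall>(x, y, z)\<in>Gamma_set U J. det (E_mat G x y z) \<noteq> 0)"

definition cond_G1_star where
  "cond_G1_star G U J \<longleftrightarrow>
     (\<forall>y\<in>proj2 U. \<forall>z. inj_on (\<lambda>x. Q_map G x y z) {x. (x, y, z) \<in> Gamma_set U J})"

subsection \<open>Local inverses\<close>

text \<open>The inverse of \<open>f\<close> restricted to some open neighbourhood of \<open>a\<close> on which \<open>f\<close> is a homeomorphism
  onto an open set. The choice does not matter: any two such inverses agree near \<open>f a\<close>, and where
  the inverse function theorem applies to \<open>f\<close> they are as smooth as the inverse it provides.\<close>

definition local_inverse ::
  "('a::topological_space \<Rightarrow> 'b::topological_space) \<Rightarrow> 'a set \<Rightarrow> 'a \<Rightarrow> 'b \<Rightarrow> 'a" where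
  "local_inverse f S a =
     (SOME g. \<exists>V W. open V \<and> a \<in> V \<and> V \<subseteq> S \<and> open W \<and> homeomorphism V W f g)"

subsection \<open>The matrix \<open>A\<close>\<close>

definition Gamma' where
  "Gamma' G U J = {(x, u, p). \<exists>y z. (x, y, z) \<in> Gamma_set U J \<and> u = G x y z \<and> p = Gx G x y z}"

definition YZ where
  "YZ G U J x u p = (THE (y, z). (x, y, z) \<in> Gamma_set U J \<and> Gx G x y z = p \<and> G x y z = u)"

text \<open>\<open>YZ\<close> inverts $(y,z) \mapsto (G_x, G)$ on the fibre of $\Gamma$ only, and $\Gamma$ need not be open.
  \<open>YZ_loc\<close> is the local inverse of the same map, on the open set where $G$ is defined, through the
  point \<open>YZ G U J x u p\<close>; it is a function of $(p', u')$ near $(p, u)$.\<close>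

definition YZ_loc where
  "YZ_loc G U I J x u p =
     local_inverse (\<lambda>(y, z). (Gx G x y z, G x y z)) {(y, z). (x, y) \<in> U \<and> z \<in> I} (YZ G U J x u p)"

text \<open>$A(x,u,\cdot)$, near $p$.\<close>

definition A_mat where
  "A_mat G U I J x u p p' = (let (y, z) = YZ_loc G U I J x u p (p', u) in Gxx G x y z)"

definition form_A where
  "form_A G U I J x u p \<xi> \<eta> =
     (\<Sum>i\<in>UNIV. \<Sum>j\<in>UNIV. \<Sum>k\<in>UNIV. \<Sum>l\<in>UNIV.
        pd2 k l (\<lambda>p'. A_mat G U I J x u p p' $ i $ j) p * \<xi> $ i * \<xi> $ j * \<eta> $ k * \<eta> $ l)"

definition cond_G3 where
  "cond_G3 G U I J \<longleftrightarrow>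
     (\<forall>(x, u, p)\<in>Gamma' G U J. \<forall>\<xi> \<eta>. \<xi> \<noteq> 0 \<longrightarrow> \<eta> \<noteq> 0 \<longrightarrow> \<xi> \<bullet> \<eta> = 0 \<longrightarrow>
        form_A G U I J x u p \<xi> \<eta> > 0)"

definition cond_G3w where
  "cond_G3w G U I J \<longleftrightarrow>
     (\<forall>(x, u, p)\<in>Gamma' G U J. \<forall>\<xi> \<eta>. \<xi> \<noteq> 0 \<longrightarrow> \<eta> \<noteq> 0 \<longrightarrow> \<xi> \<bullet> \<eta> = 0 \<longrightarrow>
        form_A G U I J x u p \<xi> \<eta> \<ge> 0)"

subsection \<open>The dual matrix \<open>A\<^sup>*\<close>\<close>

definition dom_A_star where
  "dom_A_star G U J = {(y, z, q). \<exists>x. (x, y, z) \<in> Gamma_set U J \<and> q = Q_map G x y z}"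

definition X_map where
  "X_map G U J y z q = (THE x. (x, y, z) \<in> Gamma_set U J \<and> Q_map G x y z = q)"

text \<open>\<open>X_loc\<close> relates to \<open>X_map\<close> as \<open>YZ_loc\<close> does to \<open>YZ\<close>. The domain below is where $Q$ is defined
  when \<open>z \<in> I\<close>, which holds for every point of \<open>dom_A_star\<close>.\<close>

definition X_loc where
  "X_loc G U J y z q =
     local_inverse (\<lambda>x. Q_map G x y z) {x. (x, y) \<in> U} (X_map G U J y z q)"

text \<open>$A^*(y,z,\cdot)$, near $q$.\<close>

definition A_star where
  "A_star G U J y z q q' =
     (let x = X_loc G U J y z q q' in
      \<chi> k l. - (pd l (\<lambda>y'. Gy G x y' z $ k / Gz G x y' z) y
                + deriv (\<lambda>z'. Gy G x y z' $ k / Gz G x y z') z * q' $ l))"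

definition form_A_star where
  "form_A_star G U J y z q \<xi> \<eta> =
     (\<Sum>i\<in>UNIV. \<Sum>j\<in>UNIV. \<Sum>k\<in>UNIV. \<Sum>l\<in>UNIV.
        pd2 i j (\<lambda>q'. A_star G U J y z q q' $ k $ l) q * \<xi> $ i * \<xi> $ j * \<eta> $ k * \<eta> $ l)"

definition cond_G3_star where
  "cond_G3_star G U J \<longleftrightarrow>
     (\<forall>(y, z, q)\<in>dom_A_star G U J. \<forall>\<xi> \<eta>. \<xi> \<noteq> 0 \<longrightarrow> \<eta> \<noteq> 0 \<longrightarrow> \<xi> \<bullet> \<eta> = 0 \<longrightarrow>
        form_A_star G U J y z q \<xi> \<eta> > 0)"

definition cond_G3w_star where
  "cond_G3w_star G U J \<longleftrightarrow>
     (\<forall>(y, z, q)\<in>dom_A_star G U J. \<forall>\<xi> \<eta>. \<xi> \<noteq> 0 \<longrightarrow> \<eta> \<noteq> 0 \<longrightarrow> \<xi> \<bullet> \<eta> = 0 \<longrightarrow>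
        form_A_star G U J y z q \<xi> \<eta> \<ge> 0)"

end

theory Submission
  imports Defs
begin

text \<open>
  Fix a point of \<open>\<Gamma>\<close> and vectors \<open>\<xi>\<close>, \<open>v\<close> with \<open>\<xi> \<bullet> E v = 0\<close>, and put \<open>\<eta> = E v\<close>, \<open>\<zeta> = D\<^sub>x Q \<xi>\<close>. As
  \<open>D\<^sub>x Q\<close> is \<open>- E / G\<^sub>z\<close> up to transposition, \<open>\<zeta> \<bullet> v = 0\<close>, and \<open>(\<xi>, \<eta>) \<mapsto> (\<zeta>, v)\<close> is a bijection between
  pairs of nonzero orthogonal vectors. Let \<open>x(s)\<close> solve \<open>Q(x(s), y\<^sub>0, z\<^sub>0) = q + s \<zeta>\<close>, let \<open>(y(t), z(t))\<close>
  solve \<open>(G\<^sub>x, G)(x\<^sub>0, y(t), z(t)) = (p + t \<eta>, u)\<close>, and let \<open>a(s)\<close> be the second \<open>t\<close>-derivative of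
  \<open>G(x(s), y(t), z(t))\<close> at \<open>t = 0\<close>.

  Interchanging the derivatives, \<open>a''(0)\<close> is the second \<open>t\<close>-derivative of the second \<open>s\<close>-derivative at
  \<open>s = 0\<close>. The acceleration of \<open>x(s)\<close> contributes only a term affine in \<open>t\<close>, so \<open>a''(0)\<close> is the form
  of G3 in the directions \<open>\<xi>\<close>, \<open>\<eta>\<close>; orthogonality of \<open>\<xi>\<close> and \<open>\<eta>\<close> gives \<open>a(0) = a'(0) = 0\<close>.
  On the other hand \<open>G\<^sub>y = - G\<^sub>z Q\<close> and \<open>\<zeta> \<bullet> v = 0\<close> give \<open>a(s) = G\<^sub>z b(s)\<close>, where \<open>b(s)\<close> differs from
  minus the quadratic form \<open>A\<^sup>*(q + s \<zeta>)\<close> at \<open>v\<close> by an affine function of \<open>s\<close>. Hence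
  \<open>a''(0) = G\<^sub>z b''(0)\<close>, so the two forms differ by the positive factor \<open>- G\<^sub>z\<close>.
\<close>

section \<open>Directional derivatives and smooth functions\<close>

text \<open>The direction comes first so that \<open>dir_deriv v\<close> maps functions to functions
  and can be iterated; the successor clause of \<open>Ck_on\<close> is about exactly these
  functions.\<close>

definition dir_deriv :: "'a::real_normed_vector \<Rightarrow> ('a \<Rightarrow> 'b::real_normed_vector) \<Rightarrow> 'a \<Rightarrow> 'b" where
  "dir_deriv v f x = frechet_derivative f (at x) v"

lemma dir_deriv_eq: "(f has_derivative f') (at x) \<Longrightarrow> dir_deriv v f x = f' v"
  unfolding dir_deriv_def by (metis frechet_derivative_at)

lemma has_derivative_dir_deriv:
  "f differentiable (at x) \<Longrightarrow> (f has_derivative (\<lambda>v. dir_deriv v f x)) (at x)"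
  unfolding dir_deriv_def using frechet_derivative_works by blast

lemma linear_dir_deriv: "f differentiable (at x) \<Longrightarrow> linear (\<lambda>v. dir_deriv v f x)"
  using has_derivative_dir_deriv has_derivative_linear by blast

lemma dir_deriv_cong:
  assumes "open S" "x \<in> S" "f differentiable (at x)" "\<And>x. x \<in> S \<Longrightarrow> f x = g x"
  shows "dir_deriv v f x = dir_deriv v g x"
  unfolding dir_deriv_def using frechet_derivative_transform_within_open[OF assms(3,1,2,4)] by simp

lemma differentiable_cong_open:
  assumes "open S" "x \<in> S" "f differentiable (at x)" "\<And>x. x \<in> S \<Longrightarrow> f x = g x"
  shows "g differentiable (at x)"
  by (meson assms differentiable_def has_derivative_transform_within_open)

text \<open>Trades a direction that varies with the point for fixed basis directions with varying
  scalar coefficients. Inductions on the order of differentiability need this, since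
  \<open>Ck_on\<close> speaks of fixed directions only.\<close>

lemma dir_deriv_Basis:
  fixes f :: "'a::euclidean_space \<Rightarrow> 'b::real_normed_vector"
  assumes "f differentiable (at x)"
  shows "dir_deriv v f x = (\<Sum>b\<in>Basis. (v \<bullet> b) *\<^sub>R dir_deriv b f x)"
proof -
  have "dir_deriv v f x = dir_deriv (\<Sum>b\<in>Basis. (v \<bullet> b) *\<^sub>R b) f x" by (simp add: euclidean_representation)
  also have "\<dots> = (\<Sum>b\<in>Basis. (v \<bullet> b) *\<^sub>R dir_deriv b f x)"
    by (simp add: linear_sum[OF linear_dir_deriv[OF assms]] linear_scale[OF linear_dir_deriv[OF assms]])
  finally show ?thesis .
qed

section \<open>Functions of class \<open>Ck_on\<close> and their closure properties\<close>

lemma Ck_on_Suc: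
  "Ck_on (Suc k) f S \<longleftrightarrow> (\<forall>x\<in>S. f differentiable (at x)) \<and> (\<forall>v. Ck_on k (dir_deriv v f) S)"
  by (simp add: dir_deriv_def[abs_def])

declare Ck_on.simps(2) [simp del]

lemma Ck_on_SucD: "Ck_on (Suc k) f S \<Longrightarrow> Ck_on k f S"
proof (induction k arbitrary: f)
  case 0
  then show ?case
    by (auto simp: Ck_on_Suc intro!: continuous_at_imp_continuous_on differentiable_imp_continuous_within)
next
  case (Suc k)
  then show ?case using Ck_on_Suc by blast
qed

lemma Ck_on_cong:
  assumes "open S" "Ck_on k f S" "\<And>x. x \<in> S \<Longrightarrow> f x = g x"
  shows "Ck_on k g S"
  using assms(2,3)
proof (induction k arbitrary: f g)
  case 0
  then show ?case by (simp cong: continuous_on_cong)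
next
  case (Suc k)
  have "Ck_on k (dir_deriv v g) S" for v
    by (rule Suc.IH[of "dir_deriv v f"]) (use Suc.prems in \<open>auto simp: Ck_on_Suc intro: dir_deriv_cong[OF \<open>open S\<close>]\<close>)
  moreover have "g differentiable (at x)" if "x \<in> S" for x
    using differentiable_cong_open[OF \<open>open S\<close> that, of f g] Suc.prems that Ck_on_Suc by blast
  ultimately show ?case by (simp add: Ck_on_Suc)
qed

text \<open>Any explicit formula for the derivative may replace \<open>dir_deriv\<close>: the two
  agree on the open set \<open>S\<close>, so the condition of order \<open>k\<close> passes from one
  to the other.\<close>

lemma Ck_on_SucI:
  assumes "open S" "\<And>x. x \<in> S \<Longrightarrow> (f has_derivative f' x) (at x)"
    and "\<And>v. Ck_on k (\<lambda>x. f' x v) S"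
  shows "Ck_on (Suc k) f S"
  unfolding Ck_on_Suc
proof safe
  show "f differentiable (at x)" if "x \<in> S" for x
    using assms(2) that differentiable_def by blast
  show "Ck_on k (dir_deriv v f) S" for v
    by (rule Ck_on_cong[OF assms(1) assms(3)[of v]]) (use dir_deriv_eq assms(2) in metis)
qed

lemma Ck_on_SucE:
  assumes "Ck_on (Suc k) f S" "x \<in> S"
  shows "(f has_derivative (\<lambda>v. dir_deriv v f x)) (at x)"
  using assms Ck_on_Suc has_derivative_dir_deriv by blast

lemma Ck_on_subset: "Ck_on k f S \<Longrightarrow> T \<subseteq> S \<Longrightarrow> Ck_on k f T"
  by (induction k arbitrary: f) (auto simp: Ck_on_Suc intro: continuous_on_subset)

lemma Ck_on_const: "open S \<Longrightarrow> Ck_on k (\<lambda>x. c) S"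
proof (induction k arbitrary: c)
  case (Suc k)
  then show ?case by (intro Ck_on_SucI[where f' = "\<lambda>_ _. 0"]) auto
qed auto

lemma Ck_on_linear: "open S \<Longrightarrow> bounded_linear f \<Longrightarrow> Ck_on k f S"
proof (cases k)
  case (Suc n)
  assume "open S" "bounded_linear f"
  then show ?thesis unfolding Suc
    by (intro Ck_on_SucI[where f' = "\<lambda>_. f"] Ck_on_const bounded_linear_imp_has_derivative)
qed (simp add: linear_continuous_on)

lemma Ck_on_add: "open S \<Longrightarrow> Ck_on k f S \<Longrightarrow> Ck_on k g S \<Longrightarrow> Ck_on k (\<lambda>x. f x + g x) S"
proof (induction k arbitrary: f g)
  case (Suc k)
  then show ?case
    by (intro Ck_on_SucI[where f' = "\<lambda>x v. dir_deriv v f x + dir_deriv v g x"])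
      (auto simp: Ck_on_Suc intro!: has_derivative_add has_derivative_dir_deriv)
qed (auto intro: continuous_on_add)

lemma Ck_on_sum:
  assumes "open S" "\<And>i. i \<in> A \<Longrightarrow> Ck_on k (f i) S"
  shows "Ck_on k (\<lambda>x. \<Sum>i\<in>A. f i x) S"
  using assms(2)
  by (induction A rule: infinite_finite_induct) (auto intro: Ck_on_const Ck_on_add assms(1))

text \<open>By the product rule the derivative is a sum of two products of the same kind, with one
  factor differentiated and the other regarded as one order less regular; hence both functions vary
  in the induction.\<close>

lemma Ck_on_bilinear:
  assumes "bounded_bilinear mul" "open S"
  shows "Ck_on k f S \<Longrightarrow> Ck_on k g S \<Longrightarrow> Ck_on k (\<lambda>x. mul (f x) (g x)) S"
proof (induction k arbitrary: f g)
  case 0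
  then show ?case using bounded_bilinear.continuous_on[OF assms(1)] by auto
next
  case (Suc k)
  show ?case
  proof (rule Ck_on_SucI[OF \<open>open S\<close>, where f' = "\<lambda>x v. mul (f x) (dir_deriv v g x) + mul (dir_deriv v f x) (g x)"])
    show "((\<lambda>x. mul (f x) (g x)) has_derivative
      (\<lambda>v. mul (f x) (dir_deriv v g x) + mul (dir_deriv v f x) (g x))) (at x)" if "x \<in> S" for x
      by (rule bounded_bilinear.FDERIV[OF assms(1)]) (use Suc.prems that Ck_on_SucE in blast)+
    show "Ck_on k (\<lambda>x. mul (f x) (dir_deriv v g x) + mul (dir_deriv v f x) (g x)) S" for v
      by (intro Ck_on_add assms(2) Suc.IH) (use Suc.prems Ck_on_SucD Ck_on_Suc in blast)+
  qed
qed

lemma Ck_on_linear_comp: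
  assumes "bounded_linear h" "open S"
  shows "Ck_on k f S \<Longrightarrow> Ck_on k (\<lambda>x. h (f x)) S"
proof (induction k arbitrary: f)
  case 0
  then show ?case using bounded_linear.continuous_on[OF assms(1)] by auto
next
  case (Suc k)
  show ?case
    by (rule Ck_on_SucI[OF \<open>open S\<close>, where f' = "\<lambda>x v. h (dir_deriv v f x)"])
      (use Suc.prems in \<open>auto intro!: bounded_linear.has_derivative[OF assms(1)] Ck_on_SucE Suc.IH simp: Ck_on_Suc\<close>)
qed

lemmas Ck_on_scaleR = Ck_on_bilinear[OF bounded_bilinear_scaleR]
lemmas Ck_on_mult = Ck_on_bilinear[OF bounded_bilinear_mult]
lemmas Ck_on_inner = Ck_on_bilinear[OF bounded_bilinear_inner]

text \<open>The chain rule differentiates \<open>f\<close> in the moving direction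
  \<open>dir_deriv v g x\<close>. Expanded in the basis, this becomes a sum of scalar coefficients
  times \<open>dir_deriv b f\<close> composed with \<open>g\<close>, and the induction hypothesis
  applies to each \<open>dir_deriv b f\<close>.\<close>

lemma Ck_on_compose:
  fixes f :: "'b::euclidean_space \<Rightarrow> 'c::real_normed_vector" and g :: "'a::real_normed_vector \<Rightarrow> 'b"
  assumes "open S" "g ` S \<subseteq> T"
  shows "Ck_on k f T \<Longrightarrow> Ck_on k g S \<Longrightarrow> Ck_on k (\<lambda>x. f (g x)) S"
proof (induction k arbitrary: f)
  case 0
  then show ?case using continuous_on_compose2 assms by auto
next
  case (Suc k)
  show ?case
  proof (rule Ck_on_SucI[OF \<open>open S\<close>])
    fix x assume "x \<in> S"
    then have gx: "g x \<in> T" using assms by auto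
    have 1: "(g has_derivative (\<lambda>v. dir_deriv v g x)) (at x)" using Suc.prems \<open>x \<in> S\<close> Ck_on_SucE by blast
    have 2: "(f has_derivative (\<lambda>v. dir_deriv v f (g x))) (at (g x))" using Suc.prems gx Ck_on_SucE by blast
    have 3: "dir_deriv (dir_deriv v g x) f (g x) =
      (\<Sum>b\<in>Basis. (dir_deriv v g x \<bullet> b) *\<^sub>R dir_deriv b f (g x))" for v
      by (rule dir_deriv_Basis) (use 2 in \<open>auto simp: differentiable_def\<close>)
    show "((\<lambda>x. f (g x)) has_derivative
      (\<lambda>v. \<Sum>b\<in>Basis. (dir_deriv v g x \<bullet> b) *\<^sub>R dir_deriv b f (g x))) (at x)"
      using has_derivative_compose[OF 1 2] unfolding 3 .
  next
    show "Ck_on k (\<lambda>x. \<Sum>b\<in>Basis. (dir_deriv v g x \<bullet> b) *\<^sub>R dir_deriv b f (g x)) S" for v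
      by (intro Ck_on_sum Ck_on_scaleR Ck_on_inner assms(1) Ck_on_const Suc.IH)
        (use Suc.prems Ck_on_SucD Ck_on_Suc in blast)+
  qed
qed

text \<open>The derivative is a polynomial in \<open>inverse\<close> itself, so each order follows
  from the preceding one.\<close>

lemma Ck_on_inverse: "Ck_on k (inverse :: real \<Rightarrow> real) (- {0})"
proof (induction k)
  case 0
  show ?case by (auto intro!: continuous_intros)
next
  case (Suc k)
  show ?case
    by (rule Ck_on_SucI[where f' = "\<lambda>x v. - (inverse x * v * inverse x)"])
      (auto simp: open_Compl intro!: has_derivative_inverse' Ck_on_linear_comp[OF bounded_linear_minus[OF bounded_linear_ident]] Ck_on_mult Ck_on_const Suc)
qed

lemma Ck_on_Pair:
  assumes "open S"
  shows "Ck_on k f S \<Longrightarrow> Ck_on k g S \<Longrightarrow> Ck_on k (\<lambda>x. (f x, g x)) S"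
proof (induction k arbitrary: f g)
  case (Suc k)
  then show ?case
    by (intro Ck_on_SucI[where f' = "\<lambda>x v. (dir_deriv v f x, dir_deriv v g x)"])
      (auto simp: assms Ck_on_Suc intro!: has_derivative_Pair has_derivative_dir_deriv)
qed (auto intro: continuous_on_Pair)

section \<open>Closure properties of smooth functions\<close>

lemma smooth_on_differentiable: "smooth_on f S \<Longrightarrow> x \<in> S \<Longrightarrow> f differentiable (at x)"
  unfolding smooth_on_def using Ck_on_Suc by blast

lemma smooth_on_dir_deriv: "smooth_on f S \<Longrightarrow> smooth_on (dir_deriv v f) S"
  unfolding smooth_on_def using Ck_on_Suc by blast

lemma smooth_on_has_derivative:
  "smooth_on f S \<Longrightarrow> x \<in> S \<Longrightarrow> (f has_derivative (\<lambda>v. dir_deriv v f x)) (at x)"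
  using smooth_on_differentiable has_derivative_dir_deriv by blast

lemma smooth_on_imp_continuous_on: "smooth_on f S \<Longrightarrow> continuous_on S f"
  unfolding smooth_on_def using Ck_on.simps(1) by blast

lemma smooth_on_cong: "open S \<Longrightarrow> smooth_on f S \<Longrightarrow> (\<And>x. x \<in> S \<Longrightarrow> f x = g x) \<Longrightarrow> smooth_on g S"
  unfolding smooth_on_def using Ck_on_cong by metis

lemma smooth_on_subset: "smooth_on f S \<Longrightarrow> T \<subseteq> S \<Longrightarrow> smooth_on f T"
  unfolding smooth_on_def using Ck_on_subset by blast

lemma smooth_on_compose:
  fixes f :: "'b::euclidean_space \<Rightarrow> 'c::real_normed_vector" and g :: "'a::real_normed_vector \<Rightarrow> 'b"
  shows "smooth_on f T \<Longrightarrow> smooth_on g S \<Longrightarrow> open S \<Longrightarrow> g ` S \<subseteq> T \<Longrightarrow> smooth_on (\<lambda>x. f (g x)) S"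
  unfolding smooth_on_def using Ck_on_compose by metis

lemma smooth_on_const: "open S \<Longrightarrow> smooth_on (\<lambda>x. c) S"
  by (simp add: smooth_on_def Ck_on_const)

lemma smooth_on_linear: "open S \<Longrightarrow> bounded_linear f \<Longrightarrow> smooth_on f S"
  by (simp add: smooth_on_def Ck_on_linear)

lemma smooth_on_linear_comp: "bounded_linear h \<Longrightarrow> open S \<Longrightarrow> smooth_on f S \<Longrightarrow> smooth_on (\<lambda>x. h (f x)) S"
  by (simp add: smooth_on_def Ck_on_linear_comp)

lemma smooth_on_add: "open S \<Longrightarrow> smooth_on f S \<Longrightarrow> smooth_on g S \<Longrightarrow> smooth_on (\<lambda>x. f x + g x) S"
  by (simp add: smooth_on_def Ck_on_add)

lemma smooth_on_sum: "open S \<Longrightarrow> (\<And>i. i \<in> A \<Longrightarrow> smooth_on (f i) S) \<Longrightarrow> smooth_on (\<lambda>x. \<Sum>i\<in>A. f i x) S"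
  by (simp add: smooth_on_def Ck_on_sum)

lemma smooth_on_scaleR: "open S \<Longrightarrow> smooth_on f S \<Longrightarrow> smooth_on g S \<Longrightarrow> smooth_on (\<lambda>x. f x *\<^sub>R g x) S"
  by (simp add: smooth_on_def Ck_on_scaleR)

lemma smooth_on_mult:
  fixes f g :: "'a::real_normed_vector \<Rightarrow> real"
  shows "open S \<Longrightarrow> smooth_on f S \<Longrightarrow> smooth_on g S \<Longrightarrow> smooth_on (\<lambda>x. f x * g x) S"
  by (simp add: smooth_on_def Ck_on_mult)

lemma smooth_on_inner: "open S \<Longrightarrow> smooth_on f S \<Longrightarrow> smooth_on g S \<Longrightarrow> smooth_on (\<lambda>x. f x \<bullet> g x) S"
  by (simp add: smooth_on_def Ck_on_inner)

lemma smooth_on_Pair: "open S \<Longrightarrow> smooth_on f S \<Longrightarrow> smooth_on g S \<Longrightarrow> smooth_on (\<lambda>x. (f x, g x)) S"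
  by (simp add: smooth_on_def Ck_on_Pair)

lemma smooth_on_minus: "open S \<Longrightarrow> smooth_on f S \<Longrightarrow> smooth_on (\<lambda>x. - f x) S"
  by (rule smooth_on_linear_comp[OF bounded_linear_minus[OF bounded_linear_ident]])

lemma smooth_on_divide:
  fixes f g :: "'a::real_normed_vector \<Rightarrow> real"
  assumes "open S" "smooth_on f S" "smooth_on g S" "\<And>x. x \<in> S \<Longrightarrow> g x \<noteq> 0"
  shows "smooth_on (\<lambda>x. f x / g x) S"
  unfolding divide_inverse
  by (intro smooth_on_mult assms smooth_on_compose[of inverse "- {0}" g])
    (use assms(4) in \<open>auto simp: smooth_on_def Ck_on_inverse\<close>)

lemma smooth_on_vec:
  fixes f :: "'a::real_normed_vector \<Rightarrow> real ^ 'n"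
  assumes "open S" "\<And>i. smooth_on (\<lambda>x. f x $ i) S"
  shows "smooth_on f S"
proof -
  have "smooth_on (\<lambda>x. \<Sum>i\<in>UNIV. f x $ i *\<^sub>R (axis i 1 :: real ^ 'n)) S"
    by (intro smooth_on_sum smooth_on_scaleR assms smooth_on_const)
  moreover have "(\<Sum>i\<in>UNIV. f x $ i *\<^sub>R (axis i 1 :: real ^ 'n)) = f x" for x
    using basis_expansion[of "f x"] by (simp add: scalar_mult_eq_scaleR)
  ultimately show ?thesis by simp
qed

lemma dir_deriv_compose:
  assumes "g differentiable (at x)" "f differentiable (at (g x))"
  shows "dir_deriv v (\<lambda>x. f (g x)) x = dir_deriv (dir_deriv v g x) f (g x)"
  by (rule dir_deriv_eq[OF has_derivative_compose[OF has_derivative_dir_deriv has_derivative_dir_deriv]]) fact+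

section \<open>Symmetry of second derivatives and smooth local inverses\<close>

lemma DERIV_along_line:
  fixes f :: "'a::real_normed_vector \<Rightarrow> real"
  assumes "f differentiable (at (c + t *\<^sub>R v))"
  shows "((\<lambda>t. f (c + t *\<^sub>R v)) has_real_derivative dir_deriv v f (c + t *\<^sub>R v)) (at t)"
proof -
  have 1: "((\<lambda>t. c + t *\<^sub>R v) has_derivative (\<lambda>h. h *\<^sub>R v)) (at t)"
    by (auto intro!: derivative_eq_intros)
  have "((\<lambda>t. f (c + t *\<^sub>R v)) has_derivative (\<lambda>h. dir_deriv (h *\<^sub>R v) f (c + t *\<^sub>R v))) (at t)"
    using has_derivative_compose[OF 1 has_derivative_dir_deriv[OF assms]] .
  then show ?thesis
    unfolding has_field_derivative_def
    by (rule has_derivative_eq_rhs) (simp add: linear_scale[OF linear_dir_deriv[OF assms]] fun_eq_iff mult.commute)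
qed

text \<open>Two applications of the mean value theorem: along \<open>v\<close> to the difference of
  the values on two parallel edges, then along \<open>w\<close> to the resulting difference of
  \<open>dir_deriv v f\<close>. The point found stays in the parallelogram.\<close>

lemma second_difference_mvt:
  fixes f :: "'a::real_normed_vector \<Rightarrow> real"
  assumes f: "smooth_on f S" and "0 < h"
    and S: "\<And>\<alpha> \<beta>. \<alpha> \<in> {0..h} \<Longrightarrow> \<beta> \<in> {0..h} \<Longrightarrow> a + \<alpha> *\<^sub>R v + \<beta> *\<^sub>R w \<in> S"
  obtains \<alpha> \<beta> where "\<alpha> \<in> {0..h}" "\<beta> \<in> {0..h}"
    "f (a + h *\<^sub>R v + h *\<^sub>R w) - f (a + h *\<^sub>R v) - f (a + h *\<^sub>R w) + f a
      = h * (h * dir_deriv w (dir_deriv v f) (a + \<alpha> *\<^sub>R v + \<beta> *\<^sub>R w))"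
proof -
  let ?\<phi> = "\<lambda>\<alpha>. f ((a + h *\<^sub>R w) + \<alpha> *\<^sub>R v) - f (a + \<alpha> *\<^sub>R v)"
  have S0: "a + \<alpha> *\<^sub>R v \<in> S" "(a + h *\<^sub>R w) + \<alpha> *\<^sub>R v \<in> S" if "0 \<le> \<alpha>" "\<alpha> \<le> h" for \<alpha>
    using S[of \<alpha> 0] S[of \<alpha> h] that \<open>0 < h\<close> by (auto simp: algebra_simps)
  have "\<exists>\<alpha>>0. \<alpha> < h \<and> ?\<phi> h - ?\<phi> 0 =
      (h - 0) * (dir_deriv v f ((a + h *\<^sub>R w) + \<alpha> *\<^sub>R v) - dir_deriv v f (a + \<alpha> *\<^sub>R v))"
    using \<open>0 < h\<close> by (rule MVT2)
      (intro DERIV_diff DERIV_along_line smooth_on_differentiable[OF f] S0; assumption)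
  then obtain \<alpha> where \<alpha>: "0 < \<alpha>" "\<alpha> < h"
    "?\<phi> h - ?\<phi> 0 = h * (dir_deriv v f ((a + h *\<^sub>R w) + \<alpha> *\<^sub>R v) - dir_deriv v f (a + \<alpha> *\<^sub>R v))"
    by auto
  let ?\<psi> = "\<lambda>\<beta>. dir_deriv v f ((a + \<alpha> *\<^sub>R v) + \<beta> *\<^sub>R w)"
  have "\<exists>\<beta>>0. \<beta> < h \<and> ?\<psi> h - ?\<psi> 0 = (h - 0) * dir_deriv w (dir_deriv v f) ((a + \<alpha> *\<^sub>R v) + \<beta> *\<^sub>R w)"
    using \<open>0 < h\<close> by (rule MVT2)
      (intro DERIV_along_line smooth_on_differentiable[OF smooth_on_dir_deriv[OF f]] S; use \<alpha> in auto)
  then obtain \<beta> where "0 < \<beta>" "\<beta> < h"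
    "?\<psi> h - ?\<psi> 0 = h * dir_deriv w (dir_deriv v f) ((a + \<alpha> *\<^sub>R v) + \<beta> *\<^sub>R w)"
    by auto
  with \<alpha> that[of \<alpha> \<beta>] show ?thesis by (simp add: algebra_simps)
qed

text \<open>The second difference is symmetric in \<open>v\<close> and \<open>w\<close>. So on every
  small parallelogram each mixed derivative attains one and the same value somewhere, and continuity
  at \<open>a\<close> makes the two agree there.\<close>

lemma dir_deriv_commute:
  fixes f :: "'a::real_normed_vector \<Rightarrow> real"
  assumes "open S" and f: "smooth_on f S" and "a \<in> S"
  shows "dir_deriv w (dir_deriv v f) a = dir_deriv v (dir_deriv w f) a"
proof (rule ccontr)
  let ?A = "dir_deriv w (dir_deriv v f)" and ?B = "dir_deriv v (dir_deriv w f)"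
  assume "?A a \<noteq> ?B a"
  \<comment> \<open>Half of the supposed gap: numbers closer than \<open>e\<close> to
    \<open>?A a\<close> and to \<open>?B a\<close> respectively cannot coincide.\<close>
  define e where "e = \<bar>?A a - ?B a\<bar> / 2"
  have "e > 0" using \<open>?A a \<noteq> ?B a\<close> by (simp add: e_def)
  have cont: "isCont (dir_deriv y (dir_deriv x f)) a" for x y
    using smooth_on_imp_continuous_on[OF smooth_on_dir_deriv[OF smooth_on_dir_deriv[OF f]]] assms
      continuous_on_eq_continuous_at by blast
  from cont[of w v] \<open>e > 0\<close> obtain d1 where d1: "d1 > 0" "\<And>x. dist x a < d1 \<Longrightarrow> dist (?A x) (?A a) < e"
    unfolding continuous_at_eps_delta by blast
  from cont[of v w] \<open>e > 0\<close> obtain d2 where d2: "d2 > 0" "\<And>x. dist x a < d2 \<Longrightarrow> dist (?B x) (?B a) < e"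
    unfolding continuous_at_eps_delta by blast
  from \<open>open S\<close> \<open>a \<in> S\<close> obtain d3 where d3: "d3 > 0" "\<And>x. dist x a < d3 \<Longrightarrow> x \<in> S"
    by (metis open_dist)
  define d where "d = min d1 (min d2 d3)"
  \<comment> \<open>Small enough that the whole parallelogram lies within distance \<open>d\<close>
    of \<open>a\<close>; the summand 1 keeps the denominator positive when \<open>v\<close> and
    \<open>w\<close> vanish.\<close>
  define h where "h = d / (2 * (norm v + norm w + 1))"
  have pos: "norm v + norm w + 1 > 0" using norm_ge_zero[of v] norm_ge_zero[of w] by linarith
  have "d > 0" using d1 d2 d3 by (simp add: d_def)
  then have "h > 0" using pos by (simp add: h_def)
  have dist: "dist (a + \<alpha> *\<^sub>R v + \<beta> *\<^sub>R w) a < d" if "\<alpha> \<in> {0..h}" "\<beta> \<in> {0..h}" for \<alpha> \<beta>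
  proof -
    have "norm (\<alpha> *\<^sub>R v + \<beta> *\<^sub>R w) \<le> \<alpha> * norm v + \<beta> * norm w"
      using norm_triangle_ineq[of "\<alpha> *\<^sub>R v" "\<beta> *\<^sub>R w"] that by simp
    also have "\<dots> \<le> h * norm v + h * norm w" using that by (intro add_mono mult_right_mono) auto
    also have "\<dots> \<le> h * (norm v + norm w + 1)" using \<open>h > 0\<close> by (simp add: algebra_simps)
    also have "\<dots> = d / 2" using pos by (simp add: h_def field_simps)
    also have "\<dots> < d" using \<open>d > 0\<close> by simp
    finally show ?thesis by (simp add: dist_norm add.assoc)
  qed
  have S1: "a + \<alpha> *\<^sub>R v + \<beta> *\<^sub>R w \<in> S" "a + \<beta> *\<^sub>R w + \<alpha> *\<^sub>R v \<in> S" if "\<alpha> \<in> {0..h}" "\<beta> \<in> {0..h}" for \<alpha> \<beta>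
    using d3(2) dist[OF that] by (auto simp: d_def add_ac)
  obtain \<alpha> \<beta> where 1: "\<alpha> \<in> {0..h}" "\<beta> \<in> {0..h}"
    "f (a + h *\<^sub>R v + h *\<^sub>R w) - f (a + h *\<^sub>R v) - f (a + h *\<^sub>R w) + f a
      = h * (h * ?A (a + \<alpha> *\<^sub>R v + \<beta> *\<^sub>R w))"
    using second_difference_mvt[OF f \<open>h > 0\<close> S1(1)] by blast
  obtain \<gamma> \<delta> where 2: "\<gamma> \<in> {0..h}" "\<delta> \<in> {0..h}"
    "f (a + h *\<^sub>R w + h *\<^sub>R v) - f (a + h *\<^sub>R w) - f (a + h *\<^sub>R v) + f a
      = h * (h * ?B (a + \<gamma> *\<^sub>R w + \<delta> *\<^sub>R v))"
    by (rule second_difference_mvt[OF f \<open>h > 0\<close>, of a w v]) (use S1(2) in auto)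
  have "h * (h * ?A (a + \<alpha> *\<^sub>R v + \<beta> *\<^sub>R w)) = h * (h * ?B (a + \<gamma> *\<^sub>R w + \<delta> *\<^sub>R v))"
    using 1(3) 2(3) by (simp add: algebra_simps)
  then have "?A (a + \<alpha> *\<^sub>R v + \<beta> *\<^sub>R w) = ?B (a + \<delta> *\<^sub>R v + \<gamma> *\<^sub>R w)"
    using \<open>h > 0\<close> by (simp add: add_ac)
  moreover have "dist (?A (a + \<alpha> *\<^sub>R v + \<beta> *\<^sub>R w)) (?A a) < e"
    using d1(2) dist[OF 1(1,2)] by (simp add: d_def)
  moreover have "dist (?B (a + \<delta> *\<^sub>R v + \<gamma> *\<^sub>R w)) (?B a) < e"
    using d2(2) dist[OF 2(2,1)] by (simp add: d_def)
  moreover have False if "x = y" "\<bar>x - p\<bar> < \<bar>p - q\<bar> / 2" "\<bar>y - q\<bar> < \<bar>p - q\<bar> / 2" for x y p q :: real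
    using that by (simp add: abs_if field_simps split: if_splits)
  ultimately show False unfolding e_def dist_real_def by blast
qed

text \<open>At a zero of \<open>f\<close> the product rule has no term with the derivative of
  \<phi>, so continuity of \<phi> suffices. This serves to differentiate the inverse of a derivative
  when only its continuity is known.\<close>

lemma has_derivative_mult_vanishing:
  fixes f :: "'a::real_normed_vector \<Rightarrow> 'b::real_normed_vector" and \<phi> :: "'a \<Rightarrow> real"
  assumes \<phi>: "isCont \<phi> a" and f: "(f has_derivative f') (at a)" and "f a = 0"
  shows "((\<lambda>x. \<phi> x *\<^sub>R f x) has_derivative (\<lambda>v. \<phi> a *\<^sub>R f' v)) (at a)"
  unfolding has_derivative_at_within
proof
  have bl: "bounded_linear f'" using f has_derivative_bounded_linear by blast
  then show "bounded_linear (\<lambda>v. \<phi> a *\<^sub>R f' v)" by (rule bounded_linear_const_scaleR)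
  from bl obtain K where K: "\<And>x. norm (f' x) \<le> norm x * K" using bounded_linear.bounded by blast
  have 1: "((\<lambda>y. (f y - f a - f' (y - a)) /\<^sub>R norm (y - a)) \<longlongrightarrow> 0) (at a)"
    using f by (simp add: has_derivative_at_within)
  have \<phi>0: "((\<lambda>y. \<phi> y - \<phi> a) \<longlongrightarrow> 0) (at a)"
    using \<phi> by (simp add: isCont_def LIM_zero)
  \<comment> \<open>The difference quotient of the product splits into \<phi> times the remainder
    quotient of \<open>f\<close>, treated here, and the increment of \<phi> times a bounded quotient
    of \<open>f'\<close>, treated next.\<close>
  have 2: "((\<lambda>y. \<phi> y *\<^sub>R ((f y - f a - f' (y - a)) /\<^sub>R norm (y - a))) \<longlongrightarrow> \<phi> a *\<^sub>R 0) (at a)"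
    using \<phi> by (intro tendsto_scaleR 1) (simp add: isCont_def)
  have 3: "((\<lambda>y. (\<phi> y - \<phi> a) *\<^sub>R (f' (y - a) /\<^sub>R norm (y - a))) \<longlongrightarrow> 0) (at a)"
  proof (rule Lim_null_comparison)
    show "((\<lambda>y. \<bar>\<phi> y - \<phi> a\<bar> * \<bar>K\<bar>) \<longlongrightarrow> 0) (at a)"
      using tendsto_mult_left_zero[OF tendsto_rabs_zero[OF \<phi>0]] by blast
    show "\<forall>\<^sub>F y in at a. norm ((\<phi> y - \<phi> a) *\<^sub>R (f' (y - a) /\<^sub>R norm (y - a))) \<le> \<bar>\<phi> y - \<phi> a\<bar> * \<bar>K\<bar>"
    proof (rule always_eventually, rule allI)
      fix y
      have "norm (f' (y - a) /\<^sub>R norm (y - a)) \<le> \<bar>K\<bar>"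
      proof (cases "y = a")
        case False
        have "norm (f' (y - a)) \<le> norm (y - a) * \<bar>K\<bar>"
          using K[of "y - a"] mult_left_mono[OF abs_ge_self[of K] norm_ge_zero[of "y - a"]] by linarith
        then show ?thesis using False by (simp add: field_simps)
      qed simp
      then show "norm ((\<phi> y - \<phi> a) *\<^sub>R (f' (y - a) /\<^sub>R norm (y - a))) \<le> \<bar>\<phi> y - \<phi> a\<bar> * \<bar>K\<bar>"
        by (simp only: norm_scaleR real_norm_def) (simp add: mult_left_mono)
    qed
  qed
  have "((\<lambda>y. \<phi> y *\<^sub>R ((f y - f a - f' (y - a)) /\<^sub>R norm (y - a))
      + (\<phi> y - \<phi> a) *\<^sub>R (f' (y - a) /\<^sub>R norm (y - a))) \<longlongrightarrow> 0) (at a)"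
    using tendsto_add[OF 2 3] by simp
  moreover have "\<phi> y *\<^sub>R ((f y - f a - f' (y - a)) /\<^sub>R norm (y - a))
      + (\<phi> y - \<phi> a) *\<^sub>R (f' (y - a) /\<^sub>R norm (y - a)) =
      (\<phi> y *\<^sub>R f y - \<phi> a *\<^sub>R f a - \<phi> a *\<^sub>R f' (y - a)) /\<^sub>R norm (y - a)" for y
    by (simp add: \<open>f a = 0\<close> algebra_simps)
  ultimately show "((\<lambda>y. (\<phi> y *\<^sub>R f y - \<phi> a *\<^sub>R f a - \<phi> a *\<^sub>R f' (y - a)) /\<^sub>R norm (y - a)) \<longlongrightarrow> 0) (at a)"
    by simp
qed

text \<open>\<open>L y\<close> inverts the derivative of \<open>f\<close> at \<open>g y\<close> and
  is therefore the derivative of \<open>g\<close> at \<open>y\<close>. It is shown to be continuous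
  in \<open>y\<close>, then differentiable, after which the regularity of \<open>g\<close> and
  \<open>L\<close> is raised jointly.\<close>

lemma smooth_on_right_inverse:
  fixes f :: "'a::euclidean_space \<Rightarrow> 'a"
  assumes "open S" and f: "smooth_on f S" and "open W" and gS: "g ` W \<subseteq> S" and contg: "continuous_on W g"
    and fg: "\<And>y. y \<in> W \<Longrightarrow> f (g y) = y"
    and inj: "\<And>y. y \<in> W \<Longrightarrow> inj (\<lambda>v. dir_deriv v f (g y))"
  shows "smooth_on g W"
proof -
  define L where "L y = inv (\<lambda>v. dir_deriv v f (g y))" for y
  have diff: "f differentiable (at (g y))" if "y \<in> W" for y
    using smooth_on_differentiable[OF f] gS that by blast
  have linA: "linear (\<lambda>v. dir_deriv v f (g y))" if "y \<in> W" for y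
    using linear_dir_deriv diff that by blast
  have bij: "bij (\<lambda>v. dir_deriv v f (g y))" if "y \<in> W" for y
    using linear_injective_imp_surjective[OF linA inj] inj that by (simp add: bij_def)
  have AL: "dir_deriv (L y v) f (g y) = v" if "y \<in> W" for y v
    unfolding L_def by (rule surj_f_inv_f[OF bij_is_surj[OF bij[OF that]]])
  have LA: "L y (dir_deriv v f (g y)) = v" if "y \<in> W" for y v
    unfolding L_def by (rule inv_f_f[OF inj[OF that]])
  have linL: "linear (L y)" if "y \<in> W" for y
    unfolding L_def by (rule inj_linear_imp_inv_linear[OF linA[OF that] inj[OF that]])
  have gder: "(g has_derivative L y) (at y)" if "y \<in> W" for y
  proof (rule has_derivative_inverse_basic[where g = g and y = y, OF has_derivative_dir_deriv[OF diff[OF that]]])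
    show "bounded_linear (L y)" using linL[OF that] linear_linear by blast
    show "L y \<circ> (\<lambda>v. dir_deriv v f (g y)) = id" using LA[OF that] by auto
    show "continuous (at y) g" using contg \<open>open W\<close> that continuous_on_eq_continuous_at by blast
  qed (use \<open>open W\<close> that fg in auto)
  have Ader: "((\<lambda>y. dir_deriv b f (g y)) has_derivative (\<lambda>w. dir_deriv (L y w) (dir_deriv b f) (g y))) (at y)"
    if "y \<in> W" for y b
    by (rule has_derivative_compose[OF gder[OF that]])
      (use smooth_on_has_derivative[OF smooth_on_dir_deriv[OF f]] gS that in blast)
  have Lcont: "isCont (\<lambda>y. L y v) y0" if "y0 \<in> W" for y0 v
  proof -
    have "bounded_linear (L y0)" using linL[OF that] linear_linear by blast
    then obtain B where B: "B > 0" "\<And>x. norm (L y0 x) \<le> norm x * B"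
      using bounded_linear.pos_bounded by blast
    define e where "e y = B * (\<Sum>b\<in>Basis. norm (dir_deriv b f (g y0) - dir_deriv b f (g y)))" for y
    have "((\<lambda>y. dir_deriv b f (g y)) \<longlongrightarrow> dir_deriv b f (g y0)) (at y0)" for b
      using has_derivative_continuous[OF Ader[OF that]] by (simp add: isCont_def)
    then have "(e \<longlongrightarrow> B * (\<Sum>b\<in>Basis. norm (dir_deriv b f (g y0) - dir_deriv b f (g y0)))) (at y0)"
      unfolding e_def by (intro tendsto_intros)
    then have e0: "(e \<longlongrightarrow> 0) (at y0)" by simp
    \<comment> \<open>The difference \<open>L y v - L y0 v\<close> is \<open>L y0\<close> applied to
      the change of the derivative of \<open>f\<close> between \<open>g y\<close> and
      \<open>g y0\<close> in direction \<open>L y v\<close>. The factor \<open>e y\<close> bounds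
      this relative to the size of \<open>L y v\<close>.\<close>
    have key: "norm (L y v - L y0 v) \<le> e y * norm (L y v)" if "y \<in> W" for y
    proof -
      have "L y0 (dir_deriv (L y v) f (g y0) - dir_deriv (L y v) f (g y)) = L y v - L y0 v"
        using linear_diff[OF linL[OF \<open>y0 \<in> W\<close>]] LA[OF \<open>y0 \<in> W\<close>] AL[OF that] by metis
      then have "norm (L y v - L y0 v) \<le> norm (dir_deriv (L y v) f (g y0) - dir_deriv (L y v) f (g y)) * B"
        using B(2) by metis
      also have "dir_deriv (L y v) f (g y0) - dir_deriv (L y v) f (g y)
          = (\<Sum>b\<in>Basis. (L y v \<bullet> b) *\<^sub>R (dir_deriv b f (g y0) - dir_deriv b f (g y)))"
        unfolding dir_deriv_Basis[OF diff[OF \<open>y0 \<in> W\<close>], of "L y v"] dir_deriv_Basis[OF diff[OF \<open>y \<in> W\<close>], of "L y v"]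
        by (simp add: sum_subtractf scaleR_diff_right)
      also have "norm \<dots> \<le> (\<Sum>b\<in>Basis. norm (L y v) * norm (dir_deriv b f (g y0) - dir_deriv b f (g y)))"
        by (rule sum_norm_le) (auto intro!: mult_right_mono simp: Basis_le_norm)
      finally show ?thesis using B(1) by (simp add: e_def sum_distrib_left[symmetric] mult_ac)
    qed
    \<comment> \<open>Once \<open>e y\<close> is below 1/2, the estimate can be absorbed:
      \<open>L y v\<close> is at most twice as large as \<open>L y0 v\<close>, so the bound tends to
      0 with \<open>e y\<close>.\<close>
    have "\<forall>\<^sub>F y in at y0. e y < 1/2" using order_tendstoD(2)[OF e0, of "1/2"] by simp
    moreover have "\<forall>\<^sub>F y in at y0. y \<in> W" using \<open>open W\<close> \<open>y0 \<in> W\<close> eventually_at_in_open' by blast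
    ultimately have "\<forall>\<^sub>F y in at y0. norm (L y v - L y0 v) \<le> e y * (2 * norm (L y0 v))"
    proof eventually_elim
      case (elim y)
      have "e y \<ge> 0" using B(1) by (simp add: e_def sum_nonneg)
      have "norm (L y v) \<le> norm (L y0 v) + norm (L y v - L y0 v)"
        using norm_triangle_ineq[of "L y0 v" "L y v - L y0 v"] by simp
      also have "norm (L y v - L y0 v) \<le> 1/2 * norm (L y v)"
        using key[OF elim(2)] mult_right_mono[of "e y" "1/2" "norm (L y v)"] elim(1) by simp
      finally have "norm (L y v) \<le> 2 * norm (L y0 v)" by simp
      then show ?case using key[OF elim(2)] mult_left_mono[OF _ \<open>e y \<ge> 0\<close>] by (meson order_trans)
    qed
    moreover have "((\<lambda>y. e y * (2 * norm (L y0 v))) \<longlongrightarrow> 0) (at y0)"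
      using tendsto_mult_left_zero[OF e0] by blast
    ultimately have "((\<lambda>y. L y v - L y0 v) \<longlongrightarrow> 0) (at y0)" by (rule Lim_null_comparison)
    then show ?thesis by (simp add: isCont_def LIM_zero_iff)
  qed
  \<comment> \<open>The second derivative of \<open>f\<close> at \<open>g y\<close> in the
    directions \<open>L y v\<close> and \<open>L y w\<close>, expanded in the basis.\<close>
  define u where "u y v w = (\<Sum>b\<in>Basis. (L y v \<bullet> b) *\<^sub>R (\<Sum>d\<in>Basis. (L y w \<bullet> d) *\<^sub>R dir_deriv d (dir_deriv b f) (g y)))" for y v w
  have Lder: "((\<lambda>y. L y v) has_derivative (\<lambda>w. - (\<Sum>c\<in>Basis. (u y0 v w \<bullet> c) *\<^sub>R L y0 c))) (at y0)" if "y0 \<in> W" for y0 v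
  proof -
    \<comment> \<open>This is the change of the derivative of \<open>f\<close> from
      \<open>g y0\<close> to \<open>g y\<close>, applied to \<open>L y v\<close>. Each summand has a
      factor vanishing at \<open>y0\<close>, so \<open>has_derivative_mult_vanishing\<close> needs
      only the continuity of \<open>L\<close>.\<close>
    let ?r = "\<lambda>y. \<Sum>b\<in>Basis. (L y v \<bullet> b) *\<^sub>R (dir_deriv b f (g y) - dir_deriv b f (g y0))"
    have "(?r has_derivative (\<lambda>w. \<Sum>b\<in>Basis. (L y0 v \<bullet> b) *\<^sub>R (dir_deriv (L y0 w) (dir_deriv b f) (g y0) - 0))) (at y0)"
      by (intro has_derivative_sum has_derivative_mult_vanishing has_derivative_diff Ader[OF that] has_derivative_const
          continuous_intros Lcont[OF that]) simp
    moreover have "(\<lambda>w. \<Sum>b\<in>Basis. (L y0 v \<bullet> b) *\<^sub>R (dir_deriv (L y0 w) (dir_deriv b f) (g y0) - 0)) = u y0 v"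
    proof
      fix w
      have "dir_deriv b f differentiable (at (g y0))" for b
        using smooth_on_differentiable[OF smooth_on_dir_deriv[OF f]] gS that by blast
      then show "(\<Sum>b\<in>Basis. (L y0 v \<bullet> b) *\<^sub>R (dir_deriv (L y0 w) (dir_deriv b f) (g y0) - 0)) = u y0 v w"
        unfolding u_def diff_0_right by (intro sum.cong refl arg_cong2[where f = scaleR] dir_deriv_Basis)
    qed
    ultimately have r: "(?r has_derivative u y0 v) (at y0)" by (rule has_derivative_eq_rhs)
    have bl: "bounded_linear (\<lambda>x. - L y0 x)"
      using linL[OF that] linear_linear bounded_linear_minus by blast
    \<comment> \<open>With this expansion the derivative involves \<open>L\<close> only at fixed
      vectors, the form in which the later induction hypothesis is available.\<close>
    have Lexp: "L y0 x = (\<Sum>c\<in>Basis. (x \<bullet> c) *\<^sub>R L y0 c)" for x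
    proof -
      have "L y0 x = L y0 (\<Sum>c\<in>Basis. (x \<bullet> c) *\<^sub>R c)" by (simp add: euclidean_representation)
      then show ?thesis by (simp add: linear_sum[OF linL[OF that]] linear_scale[OF linL[OF that]])
    qed
    have "((\<lambda>y. - L y0 (?r y)) has_derivative (\<lambda>w. - (\<Sum>c\<in>Basis. (u y0 v w \<bullet> c) *\<^sub>R L y0 c))) (at y0)"
      using bounded_linear.has_derivative[OF bl r] unfolding Lexp[of "u y0 v w" for w] .
    then have "((\<lambda>y. - L y0 (?r y) + L y0 v) has_derivative (\<lambda>w. - (\<Sum>c\<in>Basis. (u y0 v w \<bullet> c) *\<^sub>R L y0 c))) (at y0)"
      using has_derivative_add_const by blast
    moreover have "- L y0 (?r y) + L y0 v = L y v" if "y \<in> W" for y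
    proof -
      have "?r y = dir_deriv (L y v) f (g y) - dir_deriv (L y v) f (g y0)"
        unfolding dir_deriv_Basis[OF diff[OF \<open>y0 \<in> W\<close>], of "L y v"] dir_deriv_Basis[OF diff[OF \<open>y \<in> W\<close>], of "L y v"]
        by (simp add: sum_subtractf scaleR_diff_right)
      then have "L y0 (?r y) = L y0 v - L y v"
        using linear_diff[OF linL[OF \<open>y0 \<in> W\<close>]] LA[OF \<open>y0 \<in> W\<close>] AL[OF that] by metis
      then show ?thesis by simp
    qed
    ultimately show ?thesis by (rule has_derivative_transform_within_open[OF _ \<open>open W\<close> that])
  qed
  \<comment> \<open>The derivatives of \<open>g\<close> and \<open>L\<close> are polynomial in \<open>L\<close> and in second derivatives of \<open>f\<close> along \<open>g\<close>,
    so both gain one order of differentiability at each step.\<close>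
  have "Ck_on k g W \<and> (\<forall>v. Ck_on k (\<lambda>y. L y v) W)" for k
  proof (induction k)
    case 0
    have "continuous_on W (\<lambda>y. L y v)" for v using Lcont continuous_at_imp_continuous_on by blast
    then show ?case using contg by simp
  next
    case (Suc k)
    have "Ck_on (Suc k) g W" by (rule Ck_on_SucI[OF \<open>open W\<close> gder]) (use Suc in auto)
    moreover have "Ck_on (Suc k) (\<lambda>y. L y v) W" for v
    proof (rule Ck_on_SucI[OF \<open>open W\<close> Lder])
      have "Ck_on k (\<lambda>y. dir_deriv d (dir_deriv b f) (g y)) W" for b d
        by (rule Ck_on_compose[OF \<open>open W\<close> gS])
          (use smooth_on_dir_deriv[OF smooth_on_dir_deriv[OF f]] Suc in \<open>auto simp: smooth_on_def\<close>)
      then show "Ck_on k (\<lambda>x. - (\<Sum>c\<in>Basis. (u x v w \<bullet> c) *\<^sub>R L x c)) W" for w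
        unfolding u_def using Suc
        by (intro Ck_on_linear_comp[OF bounded_linear_minus[OF bounded_linear_ident]] Ck_on_sum Ck_on_scaleR
            Ck_on_inner Ck_on_const \<open>open W\<close>) auto
    qed
    ultimately show ?case by blast
  qed
  then show ?thesis by (simp add: smooth_on_def)
qed

text \<open>\<open>local_inverse\<close> is an arbitrary choice. The inverse function theorem shows
  that a choice exists and gives a neighbourhood \<open>U'\<close> of \<open>a\<close> on which the
  derivative of \<open>f\<close> is injective. The chosen inverse is continuous, being part of a
  homeomorphism, and \<open>smooth_on_right_inverse\<close> makes it smooth where its values lie in
  \<open>U'\<close>.\<close>

lemma smooth_local_inverse:
  fixes f :: "'a::euclidean_space \<Rightarrow> 'a"
  assumes "open S" and f: "smooth_on f S" and "a \<in> S" and inj: "inj (\<lambda>v. dir_deriv v f a)"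
  obtains W where "open W" "f a \<in> W" "smooth_on (local_inverse f S a) W" "local_inverse f S a (f a) = a"
    "\<And>y. y \<in> W \<Longrightarrow> local_inverse f S a y \<in> S" "\<And>y. y \<in> W \<Longrightarrow> f (local_inverse f S a y) = y"
proof -
  define F where "F x = Blinfun (\<lambda>v. dir_deriv v f x)" for x
  have F: "blinfun_apply (F x) = (\<lambda>v. dir_deriv v f x)" if "x \<in> S" for x
    unfolding F_def using linear_dir_deriv[OF smooth_on_differentiable[OF f that]]
    by (simp add: bounded_linear_Blinfun_apply linear_linear)
  have contF: "continuous_on S F"
  proof (rule continuous_on_blinfun_componentwise)
    fix i :: 'a
    show "continuous_on S (\<lambda>x. F x i)"
      using smooth_on_imp_continuous_on[OF smooth_on_dir_deriv[OF f]] by (simp add: F cong: continuous_on_cong)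
  qed
  have bij: "bij (\<lambda>v. dir_deriv v f a)"
    using linear_injective_imp_surjective[OF linear_dir_deriv[OF smooth_on_differentiable[OF f \<open>a \<in> S\<close>]] inj] inj
    by (simp add: bij_def)
  obtain h where h: "linear h" "h \<circ> (\<lambda>v. dir_deriv v f a) = id"
    using linear_injective_left_inverse[OF linear_dir_deriv[OF smooth_on_differentiable[OF f \<open>a \<in> S\<close>]] inj] by blast
  have "Blinfun h o\<^sub>L F a = id_blinfun"
    using h by (intro blinfun_eqI) (simp add: F \<open>a \<in> S\<close> bounded_linear_Blinfun_apply linear_linear fun_eq_iff)
  then obtain U' V g g' where *: "open U'" "U' \<subseteq> S" "a \<in> U'" "open V" "f a \<in> V" "homeomorphism U' V f g"
    "\<And>y. y \<in> V \<Longrightarrow> bij (blinfun_apply (F (g y)))"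
    using inverse_function_theorem[OF \<open>open S\<close>, of f F a "Blinfun h"] contF \<open>a \<in> S\<close>
      smooth_on_has_derivative[OF f] F by metis
  have injU: "inj (\<lambda>v. dir_deriv v f x)" if "x \<in> U'" for x
  proof -
    have "f x \<in> V" "g (f x) = x" using *(6) that by (auto simp: homeomorphism_def)
    then show ?thesis using *(7)[of "f x"] F *(2) that by (auto simp: bij_def)
  qed
  let ?g = "local_inverse f S a"
  have "\<exists>V W. open V \<and> a \<in> V \<and> V \<subseteq> S \<and> open W \<and> homeomorphism V W f ?g"
    unfolding local_inverse_def using * by (intro someI_ex[of "\<lambda>g. \<exists>V W. open V \<and> a \<in> V \<and> V \<subseteq> S \<and> open W \<and> homeomorphism V W f g"]) blast
  then obtain V0 W0 where V0: "open V0" "a \<in> V0" "V0 \<subseteq> S" "open W0" "homeomorphism V0 W0 f ?g" by blast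
  have cont: "continuous_on W0 ?g" and inv: "\<And>y. y \<in> W0 \<Longrightarrow> f (?g y) = y" "\<And>y. y \<in> W0 \<Longrightarrow> ?g y \<in> V0"
    and fa: "f a \<in> W0" "?g (f a) = a"
    using V0(2,5) by (auto simp: homeomorphism_def)
  define W where "W = W0 \<inter> ?g -` U'"
  show ?thesis
  proof (rule that[of W])
    show "open W" unfolding W_def using continuous_open_preimage[OF cont V0(4) *(1)] .
    then show "smooth_on ?g W"
    proof (rule smooth_on_right_inverse[OF \<open>open S\<close> f])
      show "continuous_on W ?g" using cont continuous_on_subset W_def by blast
      show "inj (\<lambda>v. dir_deriv v f (?g y))" if "y \<in> W" for y using injU that by (simp add: W_def)
    qed (use inv V0 in \<open>auto simp: W_def\<close>)
  qed (use fa inv V0 * in \<open>auto simp: W_def\<close>)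
qed

section \<open>Derivatives along curves\<close>

lemma dir_deriv_add:
  "f differentiable (at x) \<Longrightarrow> g differentiable (at x) \<Longrightarrow>
    dir_deriv v (\<lambda>x. f x + g x) x = dir_deriv v f x + dir_deriv v g x"
  by (rule dir_deriv_eq[OF has_derivative_add[OF has_derivative_dir_deriv has_derivative_dir_deriv]])

lemma dir_deriv_diff:
  "f differentiable (at x) \<Longrightarrow> g differentiable (at x) \<Longrightarrow>
    dir_deriv v (\<lambda>x. f x - g x) x = dir_deriv v f x - dir_deriv v g x"
  by (rule dir_deriv_eq[OF has_derivative_diff[OF has_derivative_dir_deriv has_derivative_dir_deriv]])

lemma dir_deriv_inner:
  "f differentiable (at x) \<Longrightarrow> g differentiable (at x) \<Longrightarrow>
    dir_deriv v (\<lambda>x. f x \<bullet> g x) x = f x \<bullet> dir_deriv v g x + dir_deriv v f x \<bullet> g x"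
  by (rule dir_deriv_eq[OF has_derivative_inner[OF has_derivative_dir_deriv has_derivative_dir_deriv]])

lemma dir_deriv_mult:
  fixes f g :: "'a::real_normed_vector \<Rightarrow> real"
  shows "f differentiable (at x) \<Longrightarrow> g differentiable (at x) \<Longrightarrow>
    dir_deriv v (\<lambda>x. f x * g x) x = f x * dir_deriv v g x + dir_deriv v f x * g x"
  using dir_deriv_inner[of f x g v] by simp

lemma dir_deriv_sum:
  "(\<And>i. i \<in> A \<Longrightarrow> f i differentiable (at x)) \<Longrightarrow>
    dir_deriv v (\<lambda>x. \<Sum>i\<in>A. f i x) x = (\<Sum>i\<in>A. dir_deriv v (f i) x)"
  by (rule dir_deriv_eq[OF has_derivative_sum[OF has_derivative_dir_deriv]])

lemma differentiable_bounded_linear: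
  "bounded_linear h \<Longrightarrow> f differentiable (at x) \<Longrightarrow> (\<lambda>x. h (f x)) differentiable (at x)"
  unfolding differentiable_def using bounded_linear.has_derivative by blast

lemma dir_deriv_linear_comp:
  "bounded_linear h \<Longrightarrow> f differentiable (at x) \<Longrightarrow> dir_deriv v (\<lambda>x. h (f x)) x = h (dir_deriv v f x)"
  by (rule dir_deriv_eq[OF bounded_linear.has_derivative[OF _ has_derivative_dir_deriv]])

lemma dir_deriv_cmult:
  fixes f :: "'a::real_normed_vector \<Rightarrow> real"
  shows "f differentiable (at x) \<Longrightarrow> dir_deriv v (\<lambda>x. c * f x) x = c * dir_deriv v f x"
  by (rule dir_deriv_linear_comp[OF bounded_linear_mult_right])

lemma differentiable_cmult:
  fixes f :: "'a::real_normed_vector \<Rightarrow> real"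
  shows "f differentiable (at x) \<Longrightarrow> (\<lambda>x. c * f x) differentiable (at x)"
  by (rule differentiable_bounded_linear[OF bounded_linear_mult_right])

lemma dir_deriv_const [simp]: "dir_deriv v (\<lambda>x. c) x = 0"
  by (rule dir_deriv_eq[OF has_derivative_const])

lemma dir_deriv_affine: "dir_deriv v (\<lambda>t. a + t *\<^sub>R w) t = v *\<^sub>R w"
  by (rule dir_deriv_eq) (auto intro!: derivative_eq_intros)

lemma dir_deriv_fst_slice:
  assumes "h differentiable (at (x, y))"
  shows "dir_deriv v (\<lambda>x. h (x, y)) x = dir_deriv (v, 0) h (x, y)"
proof -
  have "((\<lambda>x. (x, y)) has_derivative (\<lambda>v. (v, 0))) (at x)" by (auto intro!: derivative_eq_intros)
  from has_derivative_compose[OF this has_derivative_dir_deriv[OF assms]] show ?thesis by (rule dir_deriv_eq)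
qed

lemma dir_deriv_snd_slice:
  assumes "h differentiable (at (x, y))"
  shows "dir_deriv v (\<lambda>y. h (x, y)) y = dir_deriv (0, v) h (x, y)"
proof -
  have "((\<lambda>y. (x, y)) has_derivative (\<lambda>v. (0, v))) (at y)" by (auto intro!: derivative_eq_intros)
  from has_derivative_compose[OF this has_derivative_dir_deriv[OF assms]] show ?thesis by (rule dir_deriv_eq)
qed

lemma open_slices:
  fixes S :: "('a::topological_space \<times> 'b::topological_space) set"
  assumes "open S"
  shows "open {x. (x, y) \<in> S}" "open {y. (x, y) \<in> S}"
proof -
  have "continuous_on UNIV (\<lambda>x. (x, y))" "continuous_on UNIV (\<lambda>y. (x, y))"
    by (intro continuous_intros)+
  then have "open ((\<lambda>x. (x, y)) -` S)" "open ((\<lambda>y. (x, y)) -` S)" using open_vimage[OF assms] by blast+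
  then show "open {x. (x, y) \<in> S}" "open {y. (x, y) \<in> S}" by (simp_all add: vimage_def)
qed

lemma smooth_on_fst_slice:
  fixes h :: "'a::euclidean_space \<times> 'b::euclidean_space \<Rightarrow> 'c::real_normed_vector"
  shows "open S \<Longrightarrow> smooth_on h S \<Longrightarrow> smooth_on (\<lambda>x. h (x, y)) {x. (x, y) \<in> S}"
  by (erule smooth_on_compose, intro smooth_on_Pair smooth_on_const smooth_on_linear bounded_linear_ident open_slices)
    (auto simp: open_slices)

lemma smooth_on_snd_slice:
  fixes h :: "'a::euclidean_space \<times> 'b::euclidean_space \<Rightarrow> 'c::real_normed_vector"
  shows "open S \<Longrightarrow> smooth_on h S \<Longrightarrow> smooth_on (\<lambda>y. h (x, y)) {y. (x, y) \<in> S}"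
  by (erule smooth_on_compose, intro smooth_on_Pair smooth_on_const smooth_on_linear bounded_linear_ident open_slices)
    (auto simp: open_slices)

lemma dir_deriv2_fst_slice:
  fixes h :: "'a::euclidean_space \<times> 'b::euclidean_space \<Rightarrow> 'c::real_normed_vector"
  assumes "open S" "smooth_on h S" "(x, y) \<in> S"
  shows "dir_deriv w (dir_deriv v (\<lambda>x. h (x, y))) x = dir_deriv (w, 0) (dir_deriv (v, 0) h) (x, y)"
proof -
  have "dir_deriv w (dir_deriv v (\<lambda>x. h (x, y))) x = dir_deriv w (\<lambda>x. dir_deriv (v, 0) h (x, y)) x"
    by (rule dir_deriv_cong[OF open_slices(1)[OF \<open>open S\<close>, of y]])
      (use assms in \<open>auto intro!: dir_deriv_fst_slice smooth_on_differentiable[OF smooth_on_dir_deriv[OF smooth_on_fst_slice[OF assms(1,2)]]]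
         smooth_on_differentiable[OF assms(2)]\<close>)
  also have "\<dots> = dir_deriv (w, 0) (dir_deriv (v, 0) h) (x, y)"
    by (rule dir_deriv_fst_slice) (use assms smooth_on_differentiable smooth_on_dir_deriv in blast)
  finally show ?thesis .
qed

lemma dir_deriv2_snd_slice:
  fixes h :: "'a::euclidean_space \<times> 'b::euclidean_space \<Rightarrow> 'c::real_normed_vector"
  assumes "open S" "smooth_on h S" "(x, y) \<in> S"
  shows "dir_deriv w (dir_deriv v (\<lambda>y. h (x, y))) y = dir_deriv (0, w) (dir_deriv (0, v) h) (x, y)"
proof -
  have "dir_deriv w (dir_deriv v (\<lambda>y. h (x, y))) y = dir_deriv w (\<lambda>y. dir_deriv (0, v) h (x, y)) y"
    by (rule dir_deriv_cong[OF open_slices(2)[OF \<open>open S\<close>, of x]])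
      (use assms in \<open>auto intro!: dir_deriv_snd_slice smooth_on_differentiable[OF smooth_on_dir_deriv[OF smooth_on_snd_slice[OF assms(1,2)]]]
         smooth_on_differentiable[OF assms(2)]\<close>)
  also have "\<dots> = dir_deriv (0, w) (dir_deriv (0, v) h) (x, y)"
    by (rule dir_deriv_snd_slice) (use assms smooth_on_differentiable smooth_on_dir_deriv in blast)
  finally show ?thesis .
qed

lemma dir_deriv2_cong:
  assumes "open S" "x \<in> S" "smooth_on f S" "\<And>x. x \<in> S \<Longrightarrow> f x = g x"
  shows "dir_deriv w (dir_deriv v f) x = dir_deriv w (dir_deriv v g) x"
  by (rule dir_deriv_cong[OF assms(1,2) smooth_on_differentiable[OF smooth_on_dir_deriv[OF assms(3)] assms(2)]])
    (rule dir_deriv_cong[OF assms(1) _ smooth_on_differentiable[OF assms(3)] assms(4)])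

lemma dir_deriv_curve:
  fixes c :: "real \<Rightarrow> 'b::euclidean_space"
  assumes "c differentiable (at t)" "f differentiable (at (c t))"
  shows "dir_deriv 1 (\<lambda>t. f (c t)) t = dir_deriv (dir_deriv 1 c t) f (c t)"
  by (rule dir_deriv_compose) fact+

text \<open>Second-order chain rule: the Hessian in the velocity plus the gradient in the
  acceleration.\<close>

lemma dir_deriv2_curve:
  fixes f :: "'b::euclidean_space \<Rightarrow> real" and c :: "real \<Rightarrow> 'b"
  assumes S: "open S" "smooth_on f S" and T: "open T" "smooth_on c T" "c ` T \<subseteq> S" "t \<in> T"
  shows "dir_deriv 1 (dir_deriv 1 (\<lambda>t. f (c t))) t =
    dir_deriv (dir_deriv 1 c t) (dir_deriv (dir_deriv 1 c t) f) (c t) + dir_deriv (dir_deriv 1 (dir_deriv 1 c) t) f (c t)"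
proof -
  have cd: "c differentiable (at t)" "dir_deriv 1 c differentiable (at t)" and cS: "c t \<in> S" if "t \<in> T" for t
    using T that smooth_on_differentiable smooth_on_dir_deriv by blast+
  have fd: "f differentiable (at x)" "dir_deriv v f differentiable (at x)" if "x \<in> S" for x v
    using S that smooth_on_differentiable smooth_on_dir_deriv by blast+
  have sm: "smooth_on (\<lambda>t. f (c t)) T" using smooth_on_compose S T by blast
  have comp: "(\<lambda>t. dir_deriv b f (c t)) differentiable (at t)" if "t \<in> T" for b t
    using smooth_on_differentiable[OF smooth_on_compose[OF smooth_on_dir_deriv[OF S(2)] T(2,1,3)] that] .
  have cb: "(\<lambda>t. dir_deriv 1 c t \<bullet> b) differentiable (at t)" if "t \<in> T" for t b
    by (rule differentiable_bounded_linear[OF bounded_linear_inner_left cd(2)[OF that]])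
  let ?v = "dir_deriv 1 c t" and ?a = "dir_deriv 1 (dir_deriv 1 c) t"
  \<comment> \<open>The velocity moves with \<open>t\<close>, so it is expanded in fixed directions
    before the second differentiation.\<close>
  have "dir_deriv 1 (dir_deriv 1 (\<lambda>t. f (c t))) t = dir_deriv 1 (\<lambda>t. \<Sum>b\<in>Basis. (dir_deriv 1 c t \<bullet> b) * dir_deriv b f (c t)) t"
  proof (rule dir_deriv_cong[OF T(1,4)])
    show "dir_deriv 1 (\<lambda>t. f (c t)) differentiable (at t)"
      using smooth_on_differentiable[OF smooth_on_dir_deriv[OF sm] T(4)] .
    show "dir_deriv 1 (\<lambda>t. f (c t)) t = (\<Sum>b\<in>Basis. (dir_deriv 1 c t \<bullet> b) * dir_deriv b f (c t))" if "t \<in> T" for t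
      unfolding dir_deriv_curve[OF cd(1)[OF that] fd(1)[OF cS[OF that]]]
      by (rule dir_deriv_Basis[OF fd(1)[OF cS[OF that]], unfolded real_scaleR_def])
  qed
  also have "\<dots> = (\<Sum>b\<in>Basis. (?v \<bullet> b) * dir_deriv ?v (dir_deriv b f) (c t) + (?a \<bullet> b) * dir_deriv b f (c t))"
  proof (subst dir_deriv_sum)
    show "(\<lambda>t. (dir_deriv 1 c t \<bullet> b) * dir_deriv b f (c t)) differentiable (at t)" for b
      using comp cb T(4) by (intro differentiable_mult) auto
    have "dir_deriv 1 (\<lambda>t. dir_deriv 1 c t \<bullet> b) t = ?a \<bullet> b" for b
      by (rule dir_deriv_linear_comp[OF bounded_linear_inner_left cd(2)[OF T(4)]])
    then show "(\<Sum>b\<in>Basis. dir_deriv 1 (\<lambda>t. (dir_deriv 1 c t \<bullet> b) * dir_deriv b f (c t)) t) =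
      (\<Sum>b\<in>Basis. (?v \<bullet> b) * dir_deriv ?v (dir_deriv b f) (c t) + (?a \<bullet> b) * dir_deriv b f (c t))"
      by (simp add: dir_deriv_mult[OF cb[OF T(4)] comp[OF T(4)]] dir_deriv_curve[OF cd(1)[OF T(4)] fd(2)[OF cS[OF T(4)]]])
  qed
  also have "\<dots> = dir_deriv ?v (dir_deriv ?v f) (c t) + dir_deriv ?a f (c t)"
  proof -
    \<comment> \<open>Here the velocity is frozen at the value at \<open>t\<close>, so the basis sum
      recombines into an iterated derivative in one constant direction.\<close>
    have "dir_deriv ?v (dir_deriv ?v f) (c t) = dir_deriv ?v (\<lambda>x. \<Sum>b\<in>Basis. (?v \<bullet> b) *\<^sub>R dir_deriv b f x) (c t)"
      by (rule dir_deriv_cong[OF S(1) cS[OF T(4)] fd(2)[OF cS[OF T(4)]]]) (rule dir_deriv_Basis[OF fd(1)])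
    also have "\<dots> = (\<Sum>b\<in>Basis. (?v \<bullet> b) *\<^sub>R dir_deriv ?v (dir_deriv b f) (c t))"
      using fd(2)[OF cS[OF T(4)]]
      by (subst dir_deriv_sum)
        (simp_all add: dir_deriv_cmult differentiable_cmult)
    finally show ?thesis
      using dir_deriv_Basis[OF fd(1)[OF cS[OF T(4)]], of ?a] by (simp add: sum.distrib)
  qed
  finally show ?thesis .
qed

section \<open>Partial derivatives and quadratic forms in coordinates\<close>

lemma pd_eq_dir_deriv: "f differentiable (at a) \<Longrightarrow> pd i f a = dir_deriv (axis i 1) f a"
  unfolding pd_def using DERIV_along_line[of f a 0 "axis i 1"] by (simp add: DERIV_imp_deriv)

lemma pd2_eq_dir_deriv:
  assumes "open S" "smooth_on f S" "a \<in> S"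
  shows "pd2 i j f a = dir_deriv (axis j 1) (dir_deriv (axis i 1) f) a"
proof -
  have eq: "dir_deriv (axis i 1) f x = pd i f x" if "x \<in> S" for x
    using pd_eq_dir_deriv smooth_on_differentiable[OF assms(2) that] by metis
  have d: "dir_deriv (axis i 1) f differentiable (at a)"
    using smooth_on_differentiable smooth_on_dir_deriv assms by blast
  then have "pd i f differentiable (at a)"
    using differentiable_cong_open[OF assms(1,3)] eq by blast
  then show ?thesis
    unfolding pd2_def using pd_eq_dir_deriv dir_deriv_cong[OF assms(1,3) d, of "pd i f"] eq by metis
qed

lemma dir_deriv_axis:
  fixes f :: "real ^ 'n \<Rightarrow> real"
  assumes "f differentiable (at a)"
  shows "dir_deriv v f a = (\<Sum>k\<in>UNIV. v $ k * dir_deriv (axis k 1) f a)"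
proof -
  have "dir_deriv v f a = dir_deriv (\<Sum>k\<in>UNIV. v $ k *\<^sub>R axis k 1) f a"
    using basis_expansion[of v] by (simp add: scalar_mult_eq_scaleR)
  then show ?thesis
    by (simp add: linear_sum[OF linear_dir_deriv[OF assms]] linear_scale[OF linear_dir_deriv[OF assms]])
qed

lemma sum_pd2:
  fixes f :: "real ^ 'n \<Rightarrow> real"
  assumes "open S" "smooth_on f S" "a \<in> S"
  shows "(\<Sum>k\<in>UNIV. \<Sum>l\<in>UNIV. pd2 k l f a * \<eta> $ k * \<eta> $ l) = dir_deriv \<eta> (dir_deriv \<eta> f) a"
proof -
  have d: "f differentiable (at x)" "dir_deriv v f differentiable (at x)" if "x \<in> S" for x v
    using assms that smooth_on_differentiable smooth_on_dir_deriv by blast+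
  have "dir_deriv \<eta> (dir_deriv \<eta> f) a = dir_deriv \<eta> (\<lambda>x. \<Sum>k\<in>UNIV. \<eta> $ k * dir_deriv (axis k 1) f x) a"
    by (rule dir_deriv_cong[OF assms(1,3) d(2)[OF assms(3)] dir_deriv_axis[OF d(1)]])
  also have "\<dots> = (\<Sum>k\<in>UNIV. \<eta> $ k * dir_deriv \<eta> (dir_deriv (axis k 1) f) a)"
    using d(2)[OF assms(3)] by (simp add: dir_deriv_sum differentiable_cmult dir_deriv_cmult)
  also have "\<dots> = (\<Sum>k\<in>UNIV. \<Sum>l\<in>UNIV. pd2 k l f a * \<eta> $ k * \<eta> $ l)"
    using dir_deriv_axis[OF d(2)[OF assms(3)], of \<eta>] pd2_eq_dir_deriv[OF assms]
    by (simp add: sum_distrib_left mult_ac)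
  finally show ?thesis by simp
qed

text \<open>Turns the fourfold sums of \<open>form_A\<close> and \<open>form_A_star\<close> into
  second derivatives in one variable. A straight line has no acceleration, so the second-order chain
  rule leaves only the Hessian.\<close>

lemma quadratic_form_pd2:
  fixes M :: "real ^ 'n \<Rightarrow> real ^ 'm ^ 'm"
  assumes "open S" and M: "\<And>i j. smooth_on (\<lambda>p. M p $ i $ j) S" and "a \<in> S"
  shows "(\<Sum>i\<in>UNIV. \<Sum>j\<in>UNIV. \<Sum>k\<in>UNIV. \<Sum>l\<in>UNIV.
      pd2 k l (\<lambda>p. M p $ i $ j) a * \<xi> $ i * \<xi> $ j * \<eta> $ k * \<eta> $ l) =
    dir_deriv 1 (dir_deriv 1 (\<lambda>t. \<Sum>i\<in>UNIV. \<Sum>j\<in>UNIV. \<xi> $ i * (\<xi> $ j * M (a + t *\<^sub>R \<eta>) $ i $ j))) 0"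
proof -
  let ?B = "\<lambda>p. \<Sum>i\<in>UNIV. \<Sum>j\<in>UNIV. \<xi> $ i * (\<xi> $ j * M p $ i $ j)"
  have sm: "smooth_on (\<lambda>p. \<xi> $ i * (\<xi> $ j * M p $ i $ j)) S" for i j
    by (intro smooth_on_mult smooth_on_const assms)
  have smB: "smooth_on ?B S" by (intro smooth_on_sum smooth_on_mult smooth_on_const assms)
  have d: "(\<lambda>p. M p $ i $ j) differentiable (at x)" "dir_deriv v (\<lambda>p. M p $ i $ j) differentiable (at x)" if "x \<in> S" for x v i j
    using smooth_on_differentiable[OF M that] smooth_on_differentiable[OF smooth_on_dir_deriv[OF M] that] .
  let ?T = "{t. a + t *\<^sub>R \<eta> \<in> S}"
  have "continuous_on UNIV (\<lambda>t. a + t *\<^sub>R \<eta>)" by (intro continuous_intros)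
  then have T: "open ?T" using open_vimage[OF \<open>open S\<close>] by (auto simp: vimage_def)
  have c: "smooth_on (\<lambda>t. a + t *\<^sub>R \<eta>) ?T"
    by (intro smooth_on_add smooth_on_const smooth_on_scaleR smooth_on_linear bounded_linear_ident T)
  have c1: "dir_deriv 1 (\<lambda>t. a + t *\<^sub>R \<eta>) = (\<lambda>t. \<eta>)" by (simp add: fun_eq_iff dir_deriv_affine)
  have "dir_deriv 1 (dir_deriv 1 (\<lambda>t. ?B (a + t *\<^sub>R \<eta>))) 0 = dir_deriv \<eta> (dir_deriv \<eta> ?B) (a + 0 *\<^sub>R \<eta>)
      + dir_deriv 0 ?B (a + 0 *\<^sub>R \<eta>)"
    using dir_deriv2_curve[OF \<open>open S\<close> smB T c, of 0] \<open>a \<in> S\<close> unfolding c1 by auto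
  also have "\<dots> = dir_deriv \<eta> (dir_deriv \<eta> ?B) a"
    using linear_0[OF linear_dir_deriv[OF smooth_on_differentiable[OF smB \<open>a \<in> S\<close>]]] by simp
  also have "\<dots> = dir_deriv \<eta> (\<lambda>p. \<Sum>i\<in>UNIV. \<Sum>j\<in>UNIV. \<xi> $ i * (\<xi> $ j * dir_deriv \<eta> (\<lambda>p. M p $ i $ j) p)) a"
    by (rule dir_deriv_cong[OF \<open>open S\<close> \<open>a \<in> S\<close> smooth_on_differentiable[OF smooth_on_dir_deriv[OF smB] \<open>a \<in> S\<close>]])
      (simp add: dir_deriv_sum dir_deriv_cmult differentiable_cmult differentiable_sum d)
  also have "\<dots> = (\<Sum>i\<in>UNIV. \<Sum>j\<in>UNIV. \<xi> $ i * (\<xi> $ j * dir_deriv \<eta> (dir_deriv \<eta> (\<lambda>p. M p $ i $ j)) a))"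
    using \<open>a \<in> S\<close> by (simp add: dir_deriv_sum dir_deriv_cmult differentiable_cmult differentiable_sum d)
  also have "\<dots> = (\<Sum>i\<in>UNIV. \<Sum>j\<in>UNIV. \<Sum>k\<in>UNIV. \<Sum>l\<in>UNIV.
      pd2 k l (\<lambda>p. M p $ i $ j) a * \<xi> $ i * \<xi> $ j * \<eta> $ k * \<eta> $ l)"
    unfolding sum_pd2[OF \<open>open S\<close> M \<open>a \<in> S\<close>, symmetric] by (simp add: sum_distrib_left mult_ac)
  finally show ?thesis by simp
qed

text \<open>As \<open>c 0\<close> is nonzero, \<open>b\<close> and its first derivative vanish at 0
  because those of \<open>a\<close> do. The Leibniz rule then keeps only the term with the second
  derivative of \<open>b\<close>.\<close>

lemma product_second_derivative:
  fixes b c :: "real \<Rightarrow> real"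
  assumes "open T" "0 \<in> T" "smooth_on b T" "smooth_on c T" and a: "\<And>s. s \<in> T \<Longrightarrow> a s = c s * b s"
    and "c 0 \<noteq> 0" "a 0 = 0" "dir_deriv 1 a 0 = 0"
  shows "dir_deriv 1 (dir_deriv 1 a) 0 = c 0 * dir_deriv 1 (dir_deriv 1 b) 0"
proof -
  have d: "b differentiable (at s)" "c differentiable (at s)" "dir_deriv 1 b differentiable (at s)"
    "dir_deriv 1 c differentiable (at s)" if "s \<in> T" for s
    using assms that smooth_on_differentiable smooth_on_dir_deriv by blast+
  have sm: "smooth_on (\<lambda>s. c s * b s) T" by (intro smooth_on_mult assms)
  have a1: "dir_deriv 1 a 0 = dir_deriv 1 (\<lambda>s. c s * b s) 0"
    using dir_deriv_cong[OF assms(1,2) smooth_on_differentiable[OF sm \<open>0 \<in> T\<close>], of a] a by simp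
  have a2: "dir_deriv 1 (dir_deriv 1 a) 0 = dir_deriv 1 (dir_deriv 1 (\<lambda>s. c s * b s)) 0"
    using dir_deriv2_cong[OF assms(1,2) sm, of a] a by simp
  have b0: "b 0 = 0" using a[OF \<open>0 \<in> T\<close>] assms by simp
  have b1: "dir_deriv 1 b 0 = 0" using a1 assms b0 by (simp add: dir_deriv_mult d)
  have "dir_deriv 1 (dir_deriv 1 (\<lambda>s. c s * b s)) 0 = dir_deriv 1 (\<lambda>s. c s * dir_deriv 1 b s + dir_deriv 1 c s * b s) 0"
    by (rule dir_deriv_cong[OF assms(1,2) smooth_on_differentiable[OF smooth_on_dir_deriv[OF sm] \<open>0 \<in> T\<close>]])
      (simp add: dir_deriv_mult d)
  also have "\<dots> = c 0 * dir_deriv 1 (dir_deriv 1 b) 0"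
    using b0 b1 \<open>0 \<in> T\<close> by (simp add: dir_deriv_mult dir_deriv_add d differentiable_mult)
  finally show ?thesis using a2 by simp
qed

text \<open>In terms of \<open>g\<close>, a function of \<open>(s, t)\<close>, the function
  \<open>a\<close> is the second t-derivative at \<open>t = 0\<close>. Interchanging derivatives
  turns the s-derivatives of \<open>a\<close> at 0 into second t-derivatives of s-derivatives of
  \<open>g\<close> on the line \<open>s = 0\<close>, where \<open>Fp\<close> gives the gradient of
  \<open>F\<close> in its first argument.\<close>

lemma mixed_fourth_derivative:
  fixes F :: "'a::euclidean_space \<times> 'b::euclidean_space \<Rightarrow> real" and x :: "real \<Rightarrow> 'a" and y :: "real \<Rightarrow> 'b"
  assumes "open \<Omega>" and F: "smooth_on F \<Omega>" and "open T" and "0 \<in> T" and x: "smooth_on x T" and y: "smooth_on y T"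
    and xy: "\<And>s t. s \<in> T \<Longrightarrow> t \<in> T \<Longrightarrow> (x s, y t) \<in> \<Omega>"
    and Fu: "\<And>t. t \<in> T \<Longrightarrow> F (x 0, y t) = u"
    and Fp: "\<And>t v. t \<in> T \<Longrightarrow> dir_deriv (v, 0) F (x 0, y t) = (p + t *\<^sub>R \<eta>) \<bullet> v"
    and orth: "dir_deriv 1 x 0 \<bullet> \<eta> = 0"
  defines "a \<equiv> \<lambda>s. dir_deriv 1 (dir_deriv 1 (\<lambda>t. F (x s, y t))) 0"
  shows "a 0 = 0" "dir_deriv 1 a 0 = 0"
    "dir_deriv 1 (dir_deriv 1 a) 0 = dir_deriv 1 (dir_deriv 1
       (\<lambda>t. dir_deriv (dir_deriv 1 x 0, 0) (dir_deriv (dir_deriv 1 x 0, 0) F) (x 0, y t))) 0"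
proof -
  let ?N = "T \<times> T" and ?d1 = "dir_deriv (1::real, 0::real) :: (real \<times> real \<Rightarrow> real) \<Rightarrow> _"
    and ?d2 = "dir_deriv (0::real, 1::real) :: (real \<times> real \<Rightarrow> real) \<Rightarrow> _"
  define g where "g = (\<lambda>w. F (x (fst w), y (snd w)))"
  have N: "open ?N" using \<open>open T\<close> open_Times by blast
  have g: "smooth_on g ?N"
    unfolding g_def
    by (rule smooth_on_compose[OF F]; (intro smooth_on_Pair N smooth_on_compose[OF x] smooth_on_compose[OF y] smooth_on_linear
         bounded_linear_fst bounded_linear_snd)?) (use N xy in auto)
  note sm = smooth_on_dir_deriv[OF smooth_on_dir_deriv[OF g]] smooth_on_dir_deriv[OF g]
  have slice: "dir_deriv 1 (\<lambda>s. h (s, t)) s = ?d1 h (s, t)" "dir_deriv 1 (\<lambda>t. h (s, t)) t = ?d2 h (s, t)"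
    if "smooth_on h ?N" "s \<in> T" "t \<in> T" for h s t
    using dir_deriv_fst_slice dir_deriv_snd_slice smooth_on_differentiable[OF that(1)] that by blast+
  have slice2: "dir_deriv 1 (dir_deriv 1 (\<lambda>s. h (s, t))) s = ?d1 (?d1 h) (s, t)"
    "dir_deriv 1 (dir_deriv 1 (\<lambda>t. h (s, t))) t = ?d2 (?d2 h) (s, t)"
    if "smooth_on h ?N" "s \<in> T" "t \<in> T" for h s t
    using dir_deriv2_fst_slice[OF N that(1)] dir_deriv2_snd_slice[OF N that(1)] that by blast+
  have comm: "?d1 (?d2 h) w = ?d2 (?d1 h) w" if "smooth_on h ?N" "w \<in> ?N" for h w
    using dir_deriv_commute[OF N that] .
  have aT: "a s = ?d2 (?d2 g) (s, 0)" if "s \<in> T" for s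
    using slice2(2)[OF g that \<open>0 \<in> T\<close>] by (simp add: a_def g_def)
  have a_smooth: "smooth_on (\<lambda>s. ?d2 (?d2 g) (s, 0)) T"
    by (rule smooth_on_subset[OF smooth_on_fst_slice[OF N sm(1)]]) (use \<open>0 \<in> T\<close> in auto)
  have "a 0 = dir_deriv 1 (dir_deriv 1 (\<lambda>t::real. u)) 0"
    unfolding a_def by (rule dir_deriv2_cong[OF \<open>open T\<close> \<open>0 \<in> T\<close>, symmetric]) (use Fu \<open>open T\<close> smooth_on_const in auto)
  then show "a 0 = 0" by (simp add: dir_deriv_const[abs_def])
  let ?\<xi> = "dir_deriv 1 x 0"
  have cx: "((\<lambda>s. (x s, y t)) has_derivative (\<lambda>h. (dir_deriv h x s, 0))) (at s)" if "s \<in> T" for s t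
    by (intro has_derivative_Pair smooth_on_has_derivative[OF x that] has_derivative_const)
  have csm: "smooth_on (\<lambda>s. (x s, y t)) T" for t by (intro smooth_on_Pair x \<open>open T\<close> smooth_on_const)
  have cx1: "dir_deriv 1 (\<lambda>s. (x s, y t)) s = (dir_deriv 1 x s, 0)" if "s \<in> T" for s t
    using dir_deriv_eq[OF cx[OF that]] .
  have cx2: "dir_deriv 1 (dir_deriv 1 (\<lambda>s. (x s, y t))) 0 = (dir_deriv 1 (dir_deriv 1 x) 0, 0)" for t
  proof -
    have "dir_deriv 1 (dir_deriv 1 (\<lambda>s. (x s, y t))) 0 = dir_deriv 1 (\<lambda>s. (dir_deriv 1 x s, 0)) 0"
      by (rule dir_deriv_cong[OF \<open>open T\<close> \<open>0 \<in> T\<close> smooth_on_differentiable[OF smooth_on_dir_deriv[OF csm] \<open>0 \<in> T\<close>] cx1])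
    also have "((\<lambda>s. (dir_deriv 1 x s, 0 :: 'b)) has_derivative (\<lambda>h. (dir_deriv h (dir_deriv 1 x) 0, 0))) (at 0)"
      by (intro has_derivative_Pair smooth_on_has_derivative[OF smooth_on_dir_deriv[OF x] \<open>0 \<in> T\<close>] has_derivative_const)
    note dir_deriv_eq[OF this]
    finally show ?thesis .
  qed
  \<comment> \<open>Orthogonality kills the part \<open>t *\<^sub>R \<eta>\<close> of the gradient,
    so this s-derivative is constant in \<open>t\<close>; that is why the first derivative of
    \<open>a\<close> vanishes.\<close>
  have d1g: "?d1 g (0, t) = p \<bullet> ?\<xi>" if "t \<in> T" for t
  proof -
    have "?d1 g (0, t) = dir_deriv 1 (\<lambda>s. F (x s, y t)) 0" using slice(1)[OF g \<open>0 \<in> T\<close> that] by (simp add: g_def)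
    also have "\<dots> = dir_deriv (?\<xi>, 0) F (x 0, y t)"
      using dir_deriv_curve[of "\<lambda>s. (x s, y t)" 0 F] smooth_on_differentiable[OF csm \<open>0 \<in> T\<close>]
        smooth_on_differentiable[OF F xy] cx1 \<open>0 \<in> T\<close> that by simp
    also have "\<dots> = p \<bullet> ?\<xi>" using Fp[OF that] orth by (simp add: inner_add_left inner_add_right inner_commute)
    finally show ?thesis .
  qed
  have "dir_deriv 1 a 0 = dir_deriv 1 (\<lambda>s. ?d2 (?d2 g) (s, 0)) 0"
    using dir_deriv_cong[OF \<open>open T\<close> \<open>0 \<in> T\<close> smooth_on_differentiable[OF a_smooth \<open>0 \<in> T\<close>], of a] aT by simp
  also have "\<dots> = ?d1 (?d2 (?d2 g)) (0, 0)" using slice(1)[OF sm(1)] \<open>0 \<in> T\<close> by blast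
  \<comment> \<open>The s-derivative moves inward one place at a time. Below an outer derivative the
    interchange must hold on all of \<open>?N\<close>, hence the use of
    \<open>dir_deriv_cong\<close> for the inner moves.\<close>
  also have "\<dots> = ?d2 (?d1 (?d2 g)) (0, 0)" using comm[OF sm(2)] \<open>0 \<in> T\<close> by blast
  also have "\<dots> = ?d2 (?d2 (?d1 g)) (0, 0)"
    by (rule dir_deriv_cong[OF N _ smooth_on_differentiable[OF sm(1)] comm[OF g]]) (use \<open>0 \<in> T\<close> in auto)
  also have "\<dots> = dir_deriv 1 (dir_deriv 1 (\<lambda>t. ?d1 g (0, t))) 0" using slice2(2)[OF sm(2)] \<open>0 \<in> T\<close> by simp
  also have "\<dots> = dir_deriv 1 (dir_deriv 1 (\<lambda>t::real. p \<bullet> ?\<xi>)) 0"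
    by (rule dir_deriv2_cong[OF \<open>open T\<close> \<open>0 \<in> T\<close>, symmetric]) (use d1g \<open>open T\<close> smooth_on_const in auto)
  also have "\<dots> = 0" by (simp add: dir_deriv_const[abs_def])
  finally show "dir_deriv 1 a 0 = 0" .
  let ?h = "\<lambda>t. dir_deriv (?\<xi>, 0) (dir_deriv (?\<xi>, 0) F) (x 0, y t)"
  \<comment> \<open>The contribution of the acceleration of \<open>x\<close>. By \<open>Fp\<close>
    it is affine in \<open>t\<close>, so it drops out of the second t-derivative.\<close>
  let ?k = "\<lambda>t. (p + t *\<^sub>R \<eta>) \<bullet> dir_deriv 1 (dir_deriv 1 x) 0"
  have d1d1g: "?d1 (?d1 g) (0, t) = ?h t + ?k t" if "t \<in> T" for t
  proof -
    have "?d1 (?d1 g) (0, t) = dir_deriv 1 (dir_deriv 1 (\<lambda>s. F (x s, y t))) 0"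
      using slice2(1)[OF g \<open>0 \<in> T\<close> that] by (simp add: g_def)
    also have "\<dots> = ?h t + dir_deriv (dir_deriv 1 (dir_deriv 1 x) 0, 0) F (x 0, y t)"
      using dir_deriv2_curve[OF \<open>open \<Omega>\<close> F \<open>open T\<close> csm, of t 0] xy \<open>0 \<in> T\<close> that
      by (simp add: cx1 cx2 image_subset_iff)
    finally show ?thesis using Fp[OF that] by simp
  qed
  have h_smooth: "smooth_on ?h T"
    by (rule smooth_on_compose[OF smooth_on_dir_deriv[OF smooth_on_dir_deriv[OF F]]])
      (use xy \<open>0 \<in> T\<close> in \<open>auto intro!: smooth_on_Pair smooth_on_const y \<open>open T\<close>\<close>)
  have k_smooth: "smooth_on ?k T"
    by (intro smooth_on_inner smooth_on_add smooth_on_scaleR smooth_on_const smooth_on_linear bounded_linear_ident \<open>open T\<close>)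
  have k1: "dir_deriv 1 ?k t = \<eta> \<bullet> dir_deriv 1 (dir_deriv 1 x) 0" for t
  proof -
    have "(?k has_derivative (\<lambda>h. (h *\<^sub>R \<eta>) \<bullet> dir_deriv 1 (dir_deriv 1 x) 0)) (at t)"
      by (auto intro!: derivative_eq_intros)
    from dir_deriv_eq[OF this, of 1] show ?thesis by simp
  qed
  have "dir_deriv 1 (dir_deriv 1 a) 0 = dir_deriv 1 (dir_deriv 1 (\<lambda>s. ?d2 (?d2 g) (s, 0))) 0"
    using dir_deriv2_cong[OF \<open>open T\<close> \<open>0 \<in> T\<close> a_smooth, of a] aT by simp
  also have "\<dots> = ?d1 (?d1 (?d2 (?d2 g))) (0, 0)" using slice2(1)[OF sm(1)] \<open>0 \<in> T\<close> by blast
  also have "\<dots> = ?d1 (?d2 (?d2 (?d1 g))) (0, 0)"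
  proof (rule dir_deriv_cong[OF N _ smooth_on_differentiable[OF smooth_on_dir_deriv[OF sm(1)]]])
    fix w assume w: "w \<in> ?N"
    have "?d1 (?d2 (?d2 g)) w = ?d2 (?d1 (?d2 g)) w" using comm[OF sm(2) w] .
    also have "\<dots> = ?d2 (?d2 (?d1 g)) w"
      by (rule dir_deriv_cong[OF N w smooth_on_differentiable[OF sm(1) w] comm[OF g]])
    finally show "?d1 (?d2 (?d2 g)) w = ?d2 (?d2 (?d1 g)) w" .
  qed (use \<open>0 \<in> T\<close> in auto)
  also have "\<dots> = ?d2 (?d1 (?d2 (?d1 g))) (0, 0)"
    using comm[OF sm(1)] \<open>0 \<in> T\<close> by blast
  also have "\<dots> = ?d2 (?d2 (?d1 (?d1 g))) (0, 0)"
    by (rule dir_deriv_cong[OF N _ smooth_on_differentiable[OF smooth_on_dir_deriv[OF sm(1)]] comm[OF sm(2)]])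
      (use \<open>0 \<in> T\<close> in auto)
  also have "\<dots> = dir_deriv 1 (dir_deriv 1 (\<lambda>t. ?d1 (?d1 g) (0, t))) 0"
    using slice2(2)[OF sm(1)] \<open>0 \<in> T\<close> by simp
  also have "\<dots> = dir_deriv 1 (dir_deriv 1 (\<lambda>t. ?h t + ?k t)) 0"
    by (rule dir_deriv2_cong[OF \<open>open T\<close> \<open>0 \<in> T\<close>, symmetric])
      (use d1d1g smooth_on_add[OF \<open>open T\<close> h_smooth k_smooth] in auto)
  also have "\<dots> = dir_deriv 1 (\<lambda>t. dir_deriv 1 ?h t + \<eta> \<bullet> dir_deriv 1 (dir_deriv 1 x) 0) 0"
  proof (rule dir_deriv_cong[OF \<open>open T\<close> \<open>0 \<in> T\<close> smooth_on_differentiable[OF smooth_on_dir_deriv[OF smooth_on_add[OF \<open>open T\<close> h_smooth k_smooth]] \<open>0 \<in> T\<close>]])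
    fix t assume "t \<in> T"
    show "dir_deriv 1 (\<lambda>t. ?h t + ?k t) t = dir_deriv 1 ?h t + \<eta> \<bullet> dir_deriv 1 (dir_deriv 1 x) 0"
      using dir_deriv_add[OF smooth_on_differentiable[OF h_smooth \<open>t \<in> T\<close>] smooth_on_differentiable[OF k_smooth \<open>t \<in> T\<close>]] k1 by simp
  qed
  also have "\<dots> = dir_deriv 1 (dir_deriv 1 ?h) 0"
    using dir_deriv_add[OF smooth_on_differentiable[OF smooth_on_dir_deriv[OF h_smooth] \<open>0 \<in> T\<close>] differentiable_const] by simp
  finally show "dir_deriv 1 (dir_deriv 1 a) 0 = dir_deriv 1 (dir_deriv 1 ?h) 0" .
qed

section \<open>The generating function\<close>

text \<open>By \<open>FN\<close> the first derivative along the curve is \<open>N\<close> times a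
  bracket, and \<open>z1\<close> makes the bracket vanish at \<open>t = 0\<close>, so the derivative
  of \<open>N\<close> does not enter. The lemma is applied with \<open>x\<close> at each point x(s)
  of the other curve.\<close>

lemma second_derivative_fibre_curve:
  fixes F N :: "'a::euclidean_space \<times> 'b::euclidean_space \<times> real \<Rightarrow> real" and Q :: "'a \<times> 'b \<times> real \<Rightarrow> 'b"
    and y :: "real \<Rightarrow> 'b" and z :: "real \<Rightarrow> real"
  assumes "open \<Omega>" and F: "smooth_on F \<Omega>" and N: "smooth_on N \<Omega>" and Q: "smooth_on Q \<Omega>"
    and "open T" "0 \<in> T" and y: "smooth_on y T" and z: "smooth_on z T" and yz: "\<And>t. t \<in> T \<Longrightarrow> (x, y t, z t) \<in> \<Omega>"
    and FN: "\<And>w v r. w \<in> \<Omega> \<Longrightarrow> dir_deriv (0, v, r) F w = N w * (r - Q w \<bullet> v)"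
    and z1: "dir_deriv 1 z 0 = Q (x, y 0, z 0) \<bullet> dir_deriv 1 y 0"
  shows "dir_deriv 1 (dir_deriv 1 (\<lambda>t. F (x, y t, z t))) 0 =
    N (x, y 0, z 0) * (dir_deriv 1 (dir_deriv 1 z) 0 - Q (x, y 0, z 0) \<bullet> dir_deriv 1 (dir_deriv 1 y) 0
      - dir_deriv (0, dir_deriv 1 y 0, dir_deriv 1 z 0) Q (x, y 0, z 0) \<bullet> dir_deriv 1 y 0)"
proof -
  let ?c = "\<lambda>t. (x, y t, z t)"
  have c: "smooth_on ?c T" by (intro smooth_on_Pair smooth_on_const y z \<open>open T\<close>)
  have c\<Omega>: "?c ` T \<subseteq> \<Omega>" using yz by auto
  have c1: "dir_deriv 1 ?c t = (0, dir_deriv 1 y t, dir_deriv 1 z t)" if "t \<in> T" for t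
    by (rule dir_deriv_eq[where f' = "\<lambda>h. (0, dir_deriv h y t, dir_deriv h z t)"])
      (intro has_derivative_Pair has_derivative_const smooth_on_has_derivative[OF y that] smooth_on_has_derivative[OF z that])
  have comp: "smooth_on (\<lambda>t. F (?c t)) T" "smooth_on (\<lambda>t. N (?c t)) T" "smooth_on (\<lambda>t. Q (?c t)) T"
    using smooth_on_compose[OF _ c \<open>open T\<close> c\<Omega>] F N Q by blast+
  note d = smooth_on_differentiable[OF comp(2) \<open>0 \<in> T\<close>] smooth_on_differentiable[OF comp(3) \<open>0 \<in> T\<close>]
    smooth_on_differentiable[OF smooth_on_dir_deriv[OF y] \<open>0 \<in> T\<close>] smooth_on_differentiable[OF smooth_on_dir_deriv[OF z] \<open>0 \<in> T\<close>]
  note d' = differentiable_inner[OF d(2,3)]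
  have Qc: "dir_deriv 1 (\<lambda>t. Q (?c t)) 0 = dir_deriv (0, dir_deriv 1 y 0, dir_deriv 1 z 0) Q (?c 0)"
    using dir_deriv_curve[of ?c 0 Q] smooth_on_differentiable[OF c \<open>0 \<in> T\<close>] smooth_on_differentiable[OF Q yz[OF \<open>0 \<in> T\<close>]]
      c1[OF \<open>0 \<in> T\<close>] by simp
  have "dir_deriv 1 (dir_deriv 1 (\<lambda>t. F (?c t))) 0
      = dir_deriv 1 (\<lambda>t. N (?c t) * (dir_deriv 1 z t - Q (?c t) \<bullet> dir_deriv 1 y t)) 0"
  proof (rule dir_deriv_cong[OF \<open>open T\<close> \<open>0 \<in> T\<close> smooth_on_differentiable[OF smooth_on_dir_deriv[OF comp(1)] \<open>0 \<in> T\<close>]])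
    fix t assume "t \<in> T"
    then show "dir_deriv 1 (\<lambda>t. F (?c t)) t = N (?c t) * (dir_deriv 1 z t - Q (?c t) \<bullet> dir_deriv 1 y t)"
      using dir_deriv_curve[of ?c t F] smooth_on_differentiable[OF c] smooth_on_differentiable[OF F yz] c1 FN[OF yz] by simp
  qed
  also have "\<dots> = N (?c 0) * (dir_deriv 1 (dir_deriv 1 z) 0 - (Q (?c 0) \<bullet> dir_deriv 1 (dir_deriv 1 y) 0
      + dir_deriv 1 (\<lambda>t. Q (?c t)) 0 \<bullet> dir_deriv 1 y 0))"
    using z1 by (simp only: dir_deriv_mult[OF d(1) differentiable_diff[OF d(4) d']] dir_deriv_diff[OF d(4) d']
        dir_deriv_inner[OF d(2,3)]) simp
  finally show ?thesis unfolding Qc by (simp add: algebra_simps)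
qed

section \<open>Derivatives of functions of a triple\<close>

lemma pd_triple:
  fixes h :: "(real ^ 'n) \<times> (real ^ 'm) \<times> real \<Rightarrow> real"
  assumes "h differentiable (at (x, y, z))"
  shows "pd i (\<lambda>x. h (x, y, z)) x = dir_deriv (axis i 1, 0, 0) h (x, y, z)"
    and "pd j (\<lambda>y. h (x, y, z)) y = dir_deriv (0, axis j 1, 0) h (x, y, z)"
    and "deriv (\<lambda>z. h (x, y, z)) z = dir_deriv (0, 0, 1) h (x, y, z)"
  using DERIV_along_line[of h "(x, y, z)" 0 "(axis i 1, 0, 0)"] DERIV_along_line[of h "(x, y, z)" 0 "(0, axis j 1, 0)"]
    DERIV_along_line[of h "(x, y, 0)" z "(0, 0, 1)"] assms
  unfolding pd_def by (simp_all add: DERIV_imp_deriv)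

lemma dir_deriv_triple_snd:
  fixes h :: "(real ^ 'n) \<times> (real ^ 'm) \<times> real \<Rightarrow> real"
  assumes "h differentiable (at w)"
  shows "dir_deriv (0, v, r) h w = (\<Sum>k\<in>UNIV. v $ k * dir_deriv (0, axis k 1, 0) h w) + r * dir_deriv (0, 0, 1) h w"
proof -
  note lin = linear_dir_deriv[OF assms]
  have eq: "(0, v, r) = (\<Sum>k\<in>UNIV. v $ k *\<^sub>R (0, axis k 1, 0)) + r *\<^sub>R (0 :: real ^ 'n, 0 :: real ^ 'm, 1)"
    using basis_expansion[of v] by (simp add: prod_eq_iff fst_sum snd_sum scalar_mult_eq_scaleR)
  show ?thesis by (subst eq) (simp only: linear_add[OF lin] linear_sum[OF lin] linear_scale[OF lin] real_scaleR_def)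
qed

lemma dir_deriv_triple_fst:
  fixes h :: "(real ^ 'n) \<times> (real ^ 'm) \<times> real \<Rightarrow> real"
  assumes "h differentiable (at w)"
  shows "dir_deriv (v, 0, 0) h w = (\<Sum>k\<in>UNIV. v $ k * dir_deriv (axis k 1, 0, 0) h w)"
proof -
  note lin = linear_dir_deriv[OF assms]
  have eq: "(v, 0, 0) = (\<Sum>k\<in>UNIV. v $ k *\<^sub>R (axis k 1, 0 :: real ^ 'm, 0 :: real))"
    using basis_expansion[of v] by (simp add: prod_eq_iff fst_sum snd_sum scalar_mult_eq_scaleR)
  show ?thesis by (subst eq) (simp only: linear_sum[OF lin] linear_scale[OF lin] real_scaleR_def)
qed

lemma dir_deriv_vec_nth:
  fixes f :: "'a::real_normed_vector \<Rightarrow> real ^ 'n"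
  shows "f differentiable (at x) \<Longrightarrow> dir_deriv v (\<lambda>x. f x $ i) x = dir_deriv v f x $ i"
  by (rule dir_deriv_linear_comp[OF bounded_linear_vec_nth])

lemma smooth_on_vec_nth: "open S \<Longrightarrow> smooth_on f S \<Longrightarrow> smooth_on (\<lambda>x. f x $ i) S"
  by (rule smooth_on_linear_comp[OF bounded_linear_vec_nth])

section \<open>The generating function, the matrix E and the map Q\<close>

locale generating_function =
  fixes U :: "((real ^ 'n) \<times> (real ^ 'n)) set" and I :: "real set" and G :: "'n genfun"
  assumes open_U: "open U" and open_I: "open I"
    and smooth_G: "smooth_on (\<lambda>(x, y, z). G x y z) {(x, y, z). (x, y) \<in> U \<and> z \<in> I}"
    and Gz_neg: "(x, y) \<in> U \<Longrightarrow> z \<in> I \<Longrightarrow> Gz G x y z < 0"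
begin

text \<open>Uncurried forms: derivatives in x, y and z all become \<open>dir_deriv\<close> on one
  product space, where \<open>dir_deriv_commute\<close> applies.\<close>

abbreviation \<Omega> where "\<Omega> \<equiv> {(x, y, z). (x, y) \<in> U \<and> z \<in> I}"
abbreviation F where "F \<equiv> \<lambda>(x, y, z). G x y z"
abbreviation P where "P \<equiv> \<lambda>(x, y, z). Gx G x y z"
abbreviation N where "N \<equiv> \<lambda>(x, y, z). Gz G x y z"
abbreviation Q where "Q \<equiv> \<lambda>(x, y, z). Q_map G x y z"

lemma open_\<Omega>: "open \<Omega>"
proof -
  have "continuous_on UNIV (\<lambda>w. (fst w, fst (snd w)))" "continuous_on UNIV (\<lambda>w. snd (snd w))"
    by (intro continuous_intros)+
  then have "open ((\<lambda>w. (fst w, fst (snd w))) -` U \<inter> (\<lambda>w. snd (snd w)) -` I)"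
    by (intro open_Int open_vimage open_U open_I)
  also have "\<dots> = \<Omega>" by auto
  finally show ?thesis .
qed

lemma F_diff: "w \<in> \<Omega> \<Longrightarrow> F differentiable (at w)"
  by (rule smooth_on_differentiable[OF smooth_G])

lemma Gx_nth: "(x, y, z) \<in> \<Omega> \<Longrightarrow> Gx G x y z $ i = dir_deriv (axis i 1, 0, 0) F (x, y, z)"
  and Gy_nth: "(x, y, z) \<in> \<Omega> \<Longrightarrow> Gy G x y z $ i = dir_deriv (0, axis i 1, 0) F (x, y, z)"
  and Gz_eq: "(x, y, z) \<in> \<Omega> \<Longrightarrow> Gz G x y z = dir_deriv (0, 0, 1) F (x, y, z)"
  using pd_triple(1)[OF F_diff, of x y z i] pd_triple(2)[OF F_diff, of x y z i] pd_triple(3)[OF F_diff, of x y z]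
  unfolding Gx_def Gy_def Gz_def by auto

lemma smooth_P: "smooth_on P \<Omega>"
proof (rule smooth_on_vec[OF open_\<Omega>])
  show "smooth_on (\<lambda>w. P w $ i) \<Omega>" for i
    by (rule smooth_on_cong[OF open_\<Omega> smooth_on_dir_deriv[OF smooth_G, of "(axis i 1, 0, 0)"]]) (auto simp: Gx_nth)
qed

lemma smooth_N: "smooth_on N \<Omega>"
  by (rule smooth_on_cong[OF open_\<Omega> smooth_on_dir_deriv[OF smooth_G, of "(0, 0, 1)"]]) (auto simp: Gz_eq)

lemma N_neg: "w \<in> \<Omega> \<Longrightarrow> N w < 0"
  using Gz_neg by auto

lemma smooth_Q: "smooth_on Q \<Omega>"
proof (rule smooth_on_vec[OF open_\<Omega>])
  fix i
  have "smooth_on (\<lambda>w. - (dir_deriv (0, axis i 1, 0) F w) / N w) \<Omega>"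
    by (intro smooth_on_divide smooth_on_minus smooth_on_dir_deriv[OF smooth_G] smooth_N open_\<Omega>) (use N_neg in force)
  then show "smooth_on (\<lambda>w. Q w $ i) \<Omega>"
    by (rule smooth_on_cong[OF open_\<Omega>]) (auto simp: Q_map_def Gy_nth)
qed

lemma dir_deriv_F_fst: "w \<in> \<Omega> \<Longrightarrow> dir_deriv (v, 0, 0) F w = P w \<bullet> v"
  using dir_deriv_triple_fst[OF F_diff, of w v] by (auto simp: Gx_nth inner_vec_def mult.commute)

text \<open>A form of G_y = - G_z Q. With x fixed, the direction (v, r) is tangent to the level set
  of G exactly when r = Q \<bullet> v.\<close>

lemma dir_deriv_F_snd:
  assumes "w \<in> \<Omega>"
  shows "dir_deriv (0, v, r) F w = N w * (r - Q w \<bullet> v)"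
proof -
  obtain x y z where w: "w = (x, y, z)" by (cases w)
  have "Gz G x y z * (Q w \<bullet> v) = - (\<Sum>k\<in>UNIV. v $ k * Gy G x y z $ k)"
    using N_neg[OF assms] by (simp add: w inner_vec_def Q_map_def sum_distrib_left sum_negf[symmetric] mult.commute)
  then show ?thesis
    using dir_deriv_triple_snd[OF F_diff[OF assms], of v r] assms
    by (simp add: w Gy_nth Gz_eq algebra_simps)
qed

text \<open>The rank-one correction in \<open>E_mat\<close> is the effect of moving \<open>z\<close>
  along with \<open>y\<close> so that G stays constant to first order: by
  \<open>dir_deriv_F_snd\<close> the direction used here annihilates the derivative of
  \<open>F\<close>.\<close>

lemma E_mat_mult:
  assumes w: "(x, y, z) \<in> \<Omega>"
  shows "E_mat G x y z *v v = dir_deriv (0, v, Q_map G x y z \<bullet> v) P (x, y, z)"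
proof (rule vec_eq_iff[THEN iffD2, rule_format])
  fix i
  have Pd: "P differentiable (at (x, y, z))" using smooth_on_differentiable[OF smooth_P w] .
  have hd: "(\<lambda>w. P w $ i) differentiable (at (x, y, z))"
    using smooth_on_differentiable[OF smooth_on_vec_nth[OF open_\<Omega> smooth_P] w] .
  let ?h = "\<lambda>w. P w $ i"
  have h: "pd j (\<lambda>y'. Gx G x y' z $ i) y = dir_deriv (0, axis j 1, 0) ?h (x, y, z)"
    "deriv (\<lambda>z'. Gx G x y z' $ i) z = dir_deriv (0, 0, 1) ?h (x, y, z)" for j
    using pd_triple(2,3)[OF hd] by simp_all
  have "(E_mat G x y z *v v) $ i = (\<Sum>j\<in>UNIV. v $ j * dir_deriv (0, axis j 1, 0) ?h (x, y, z))
      + (Q_map G x y z \<bullet> v) * dir_deriv (0, 0, 1) ?h (x, y, z)"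
    by (simp add: matrix_vector_mult_def E_mat_def h Q_map_def inner_vec_def sum_distrib_right sum.distrib[symmetric]
        field_simps)
  also have "\<dots> = dir_deriv (0, v, Q_map G x y z \<bullet> v) ?h (x, y, z)"
    by (rule dir_deriv_triple_snd[OF hd, symmetric])
  also have "\<dots> = dir_deriv (0, v, Q_map G x y z \<bullet> v) P (x, y, z) $ i" by (rule dir_deriv_vec_nth[OF Pd])
  finally show "(E_mat G x y z *v v) $ i = dir_deriv (0, v, Q_map G x y z \<bullet> v) P (x, y, z) $ i" .
qed

text \<open>Obtained by interchanging the x-derivative of \<open>F\<close> with its derivative in
  the level direction; the factor multiplying \<open>N\<close> vanishes at the point, so the
  derivative of \<open>N\<close> drops out. This is the relation between E and D_x Q up to
  transposition.\<close>

lemma E_mat_dual: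
  assumes w: "(x, y, z) \<in> \<Omega>"
  shows "\<xi> \<bullet> (E_mat G x y z *v v) = - Gz G x y z * (dir_deriv (\<xi>, 0, 0) Q (x, y, z) \<bullet> v)"
proof -
  \<comment> \<open>The slope \<open>?r\<close> is frozen at the given point, so that the direction
    is constant and \<open>dir_deriv_commute\<close> can be used.\<close>
  let ?w = "(x, y, z)" and ?r = "Q_map G x y z \<bullet> v"
  note Nd = smooth_on_differentiable[OF smooth_N w] and Qd = smooth_on_differentiable[OF smooth_Q w]
    and Pd = smooth_on_differentiable[OF smooth_P w]
  have Qvd: "(\<lambda>w. Q w \<bullet> v) differentiable (at ?w)"
    by (rule differentiable_bounded_linear[OF bounded_linear_inner_left Qd])
  have "\<xi> \<bullet> (E_mat G x y z *v v) = dir_deriv (0, v, ?r) (\<lambda>w. P w \<bullet> \<xi>) ?w"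
    unfolding E_mat_mult[OF w] using dir_deriv_linear_comp[OF bounded_linear_inner_left Pd] by (simp add: inner_commute)
  also have "\<dots> = dir_deriv (0, v, ?r) (dir_deriv (\<xi>, 0, 0) F) ?w"
    by (rule dir_deriv_cong[OF open_\<Omega> w smooth_on_differentiable[OF smooth_on_dir_deriv[OF smooth_G] w], symmetric])
      (rule dir_deriv_F_fst)
  also have "\<dots> = dir_deriv (\<xi>, 0, 0) (dir_deriv (0, v, ?r) F) ?w"
    by (rule dir_deriv_commute[OF open_\<Omega> smooth_G w])
  also have "\<dots> = dir_deriv (\<xi>, 0, 0) (\<lambda>w. N w * (?r - Q w \<bullet> v)) ?w"
    by (rule dir_deriv_cong[OF open_\<Omega> w smooth_on_differentiable[OF smooth_on_dir_deriv[OF smooth_G] w]])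
      (rule dir_deriv_F_snd)
  also have "\<dots> = N ?w * dir_deriv (\<xi>, 0, 0) (\<lambda>w. ?r - Q w \<bullet> v) ?w"
    using dir_deriv_mult[OF Nd differentiable_diff[OF differentiable_const Qvd]] by simp
  also have "dir_deriv (\<xi>, 0, 0) (\<lambda>w. ?r - Q w \<bullet> v) ?w = - (dir_deriv (\<xi>, 0, 0) Q ?w \<bullet> v)"
    using dir_deriv_diff[OF differentiable_const Qvd] dir_deriv_linear_comp[OF bounded_linear_inner_left Qd] by simp
  finally show ?thesis by simp
qed

lemma Gxx_quadratic:
  assumes w: "(x, y, z) \<in> \<Omega>"
  shows "(\<Sum>i\<in>UNIV. \<Sum>j\<in>UNIV. \<xi> $ i * (\<xi> $ j * Gxx G x y z $ i $ j)) =
    dir_deriv (\<xi>, 0, 0) (dir_deriv (\<xi>, 0, 0) F) (x, y, z)"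
proof -
  note sm = smooth_on_fst_slice[OF open_\<Omega> smooth_G, of "(y, z)"] and op = open_slices(1)[OF open_\<Omega>, of "(y, z)"]
  have "(\<Sum>i\<in>UNIV. \<Sum>j\<in>UNIV. \<xi> $ i * (\<xi> $ j * Gxx G x y z $ i $ j))
      = (\<Sum>i\<in>UNIV. \<Sum>j\<in>UNIV. pd2 i j (\<lambda>x. F (x, y, z)) x * \<xi> $ i * \<xi> $ j)"
    by (simp add: Gxx_def mult_ac)
  also have "\<dots> = dir_deriv \<xi> (dir_deriv \<xi> (\<lambda>x. F (x, y, z))) x"
    by (rule sum_pd2[OF op sm]) (use w in simp)
  also have "\<dots> = dir_deriv (\<xi>, 0) (dir_deriv (\<xi>, 0) F) (x, y, z)"
    by (rule dir_deriv2_fst_slice[OF open_\<Omega> smooth_G w])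
  finally show ?thesis by (simp add: zero_prod_def)
qed

lemma Gxx_nth:
  assumes w: "(x, y, z) \<in> \<Omega>"
  shows "Gxx G x y z $ i $ j = dir_deriv (axis j 1, 0, 0) (dir_deriv (axis i 1, 0, 0) F) (x, y, z)"
proof -
  note sm = smooth_on_fst_slice[OF open_\<Omega> smooth_G, of "(y, z)"] and op = open_slices(1)[OF open_\<Omega>, of "(y, z)"]
  have "Gxx G x y z $ i $ j = pd2 i j (\<lambda>x. F (x, y, z)) x" by (simp add: Gxx_def)
  also have "\<dots> = dir_deriv (axis j 1) (dir_deriv (axis i 1) (\<lambda>x. F (x, y, z))) x"
    by (rule pd2_eq_dir_deriv[OF op sm]) (use w in simp)
  also have "\<dots> = dir_deriv (axis j 1, 0) (dir_deriv (axis i 1, 0) F) (x, y, z)"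
    by (rule dir_deriv2_fst_slice[OF open_\<Omega> smooth_G w])
  finally show ?thesis by (simp add: zero_prod_def)
qed

text \<open>The minus signs in \<open>A_star\<close> and in \<open>Q_map\<close> cancel.\<close>

lemma A_star_nth:
  assumes w: "(X_loc G U J y z q q', y, z) \<in> \<Omega>"
  shows "A_star G U J y z q q' $ k $ l = dir_deriv (0, axis l 1, 0) (\<lambda>w. Q w $ k) (X_loc G U J y z q q', y, z)
    + dir_deriv (0, 0, 1) (\<lambda>w. Q w $ k) (X_loc G U J y z q q', y, z) * q' $ l"
proof -
  let ?x = "X_loc G U J y z q q'"
  have Qd: "(\<lambda>w. Q w $ k) differentiable (at (?x, y, z))"
    using smooth_on_differentiable[OF smooth_on_vec_nth[OF open_\<Omega> smooth_Q] w] .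
  have hd: "(\<lambda>w. - Q w $ k) differentiable (at (?x, y, z))" using differentiable_minus[OF Qd] .
  have neg: "dir_deriv u (\<lambda>w. - Q w $ k) (?x, y, z) = - dir_deriv u (\<lambda>w. Q w $ k) (?x, y, z)" for u
    by (rule dir_deriv_linear_comp[OF bounded_linear_minus[OF bounded_linear_ident] Qd])
  have "pd l (\<lambda>y'. Gy G ?x y' z $ k / Gz G ?x y' z) y = dir_deriv (0, axis l 1, 0) (\<lambda>w. - Q w $ k) (?x, y, z)"
    "deriv (\<lambda>z'. Gy G ?x y z' $ k / Gz G ?x y z') z = dir_deriv (0, 0, 1) (\<lambda>w. - Q w $ k) (?x, y, z)"
    using pd_triple(2,3)[OF hd] by (simp_all add: Q_map_def)
  then show ?thesis by (simp add: A_star_def Let_def neg)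
qed

text \<open>The z-term of \<open>A_star\<close> turns the y-derivative of Q into its derivative in
  the level direction of \<open>E_mat_mult\<close>, with \<open>q'\<close> in the role of Q. This
  links the dual matrix to curves on which G is constant.\<close>

lemma A_star_quadratic:
  assumes w: "(X_loc G U J y z q q', y, z) \<in> \<Omega>"
  shows "(\<Sum>k\<in>UNIV. \<Sum>l\<in>UNIV. v $ k * (v $ l * A_star G U J y z q q' $ k $ l)) =
    dir_deriv (0, v, q' \<bullet> v) Q (X_loc G U J y z q q', y, z) \<bullet> v"
proof -
  let ?w = "(X_loc G U J y z q q', y, z)"
  have Qd: "(\<lambda>w. Q w $ k) differentiable (at ?w)" for k
    using smooth_on_differentiable[OF smooth_on_vec_nth[OF open_\<Omega> smooth_Q] w] .
  have "(\<Sum>l\<in>UNIV. v $ l * A_star G U J y z q q' $ k $ l) = dir_deriv (0, v, q' \<bullet> v) (\<lambda>w. Q w $ k) ?w" for k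
    unfolding dir_deriv_triple_snd[OF Qd, of v "q' \<bullet> v"] A_star_nth[OF w]
    by (simp add: inner_vec_def sum_distrib_left sum_distrib_right sum.distrib algebra_simps)
  then show ?thesis
    by (simp add: sum_distrib_left[symmetric] inner_vec_def mult.commute
        dir_deriv_vec_nth[OF smooth_on_differentiable[OF smooth_Q w]])
qed

end

section \<open>The curves through a point\<close>

lemma sum_swap_pairs:
  "(\<Sum>i\<in>A. \<Sum>j\<in>B. \<Sum>k\<in>C. \<Sum>l\<in>D. f i j k l) = (\<Sum>k\<in>C. \<Sum>l\<in>D. \<Sum>i\<in>A. \<Sum>j\<in>B. f i j k l)"
proof -
  have "(\<Sum>i\<in>A. \<Sum>j\<in>B. \<Sum>k\<in>C. \<Sum>l\<in>D. f i j k l) = (\<Sum>i\<in>A. \<Sum>k\<in>C. \<Sum>j\<in>B. \<Sum>l\<in>D. f i j k l)"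
    by (intro sum.cong refl sum.swap)
  also have "\<dots> = (\<Sum>k\<in>C. \<Sum>i\<in>A. \<Sum>j\<in>B. \<Sum>l\<in>D. f i j k l)" by (rule sum.swap)
  also have "\<dots> = (\<Sum>k\<in>C. \<Sum>i\<in>A. \<Sum>l\<in>D. \<Sum>j\<in>B. f i j k l)" by (intro sum.cong refl sum.swap)
  also have "\<dots> = (\<Sum>k\<in>C. \<Sum>l\<in>D. \<Sum>i\<in>A. \<Sum>j\<in>B. f i j k l)" by (intro sum.cong refl sum.swap)
  finally show ?thesis .
qed

context generating_function
begin

section \<open>Local inverses and the two forms at a fixed point\<close>

context
  fixes x0 y0 :: "real ^ 'n" and z0 :: real
  assumes w0: "(x0, y0, z0) \<in> \<Omega>" and det_E: "det (E_mat G x0 y0 z0) \<noteq> 0"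
begin

abbreviation fX where "fX \<equiv> \<lambda>x. Q_map G x y0 z0"
abbreviation fY where "fY \<equiv> \<lambda>(y, z). (Gx G x0 y z, G x0 y z)"

lemma E_mat_eq_0: "E_mat G x0 y0 z0 *v v = 0 \<Longrightarrow> v = 0"
  using inj_matrix_vector_mult[of "E_mat G x0 y0 z0"] det_E invertible_det_nz
  by (metis (no_types) injD matrix_vector_mult_0_right)

lemma E_mat_surj: "\<exists>v. E_mat G x0 y0 z0 *v v = \<eta>"
proof -
  obtain B where "E_mat G x0 y0 z0 ** B = mat 1"
    using det_E invertible_det_nz invertible_def by blast
  then have "E_mat G x0 y0 z0 *v (B *v \<eta>) = \<eta>" by (simp add: matrix_vector_mul_assoc)
  then show ?thesis by blast
qed

lemma slice_X: "open {x. (x, y0) \<in> U}" "smooth_on fX {x. (x, y0) \<in> U}"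
proof -
  have eq: "{x. (x, y0) \<in> U} = {x. (x, y0, z0) \<in> \<Omega>}" using w0 by auto
  show "open {x. (x, y0) \<in> U}" unfolding eq by (rule open_slices[OF open_\<Omega>])
  show "smooth_on fX {x. (x, y0) \<in> U}"
    unfolding eq using smooth_on_fst_slice[OF open_\<Omega> smooth_Q, of "(y0, z0)"] by simp
qed

lemma slice_Y: "open {(y, z). (x0, y) \<in> U \<and> z \<in> I}" "smooth_on fY {(y, z). (x0, y) \<in> U \<and> z \<in> I}"
proof -
  have eq: "{(y, z). (x0, y) \<in> U \<and> z \<in> I} = {yz. (x0, yz) \<in> \<Omega>}" by auto
  show op: "open {(y, z). (x0, y) \<in> U \<and> z \<in> I}" unfolding eq by (rule open_slices[OF open_\<Omega>])
  have "smooth_on (\<lambda>yz. (P (x0, yz), F (x0, yz))) {(y, z). (x0, y) \<in> U \<and> z \<in> I}"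
    unfolding eq
    by (rule smooth_on_Pair[OF op[unfolded eq] smooth_on_snd_slice[OF open_\<Omega> smooth_P] smooth_on_snd_slice[OF open_\<Omega> smooth_G]])
  then show "smooth_on fY {(y, z). (x0, y) \<in> U \<and> z \<in> I}" by (simp add: case_prod_beta')
qed

lemma dir_deriv_fX: "dir_deriv \<xi> fX x0 = dir_deriv (\<xi>, 0, 0) Q (x0, y0, z0)"
  using dir_deriv_fst_slice[of Q x0 "(y0, z0)" \<xi>] smooth_on_differentiable[OF smooth_Q w0] by (simp add: zero_prod_def)

lemma dir_deriv_fY:
  "dir_deriv (v, r) fY (y0, z0) = (dir_deriv (0, v, r) P (x0, y0, z0), dir_deriv (0, v, r) F (x0, y0, z0))"
proof -
  have "((\<lambda>yz. (x0, yz)) has_derivative (\<lambda>u. (0, u))) (at (y0, z0))" by (auto intro!: derivative_eq_intros)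
  note c = has_derivative_compose[OF this]
  have "((\<lambda>yz. (P (x0, yz), F (x0, yz))) has_derivative
      (\<lambda>u. (dir_deriv (0, u) P (x0, y0, z0), dir_deriv (0, u) F (x0, y0, z0)))) (at (y0, z0))"
    by (intro has_derivative_Pair c smooth_on_has_derivative[OF smooth_P w0] smooth_on_has_derivative[OF smooth_G w0])
  moreover have "(\<lambda>yz. (P (x0, yz), F (x0, yz))) = fY" by auto
  ultimately show ?thesis using dir_deriv_eq by fastforce
qed

text \<open>By \<open>E_mat_dual\<close> a vector of the kernel is orthogonal to the range of E,
  which is the whole space.\<close>

lemma inj_dir_deriv_fX: "inj (\<lambda>\<xi>. dir_deriv \<xi> fX x0)"
proof (subst linear_injective_0, safe)
  show "linear (\<lambda>\<xi>. dir_deriv \<xi> fX x0)"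
    by (rule linear_dir_deriv[OF smooth_on_differentiable[OF slice_X(2)]]) (use w0 in simp)
  fix \<xi> assume "dir_deriv \<xi> fX x0 = 0"
  then have "\<xi> \<bullet> (E_mat G x0 y0 z0 *v v) = 0" for v
    unfolding E_mat_dual[OF w0] dir_deriv_fX by simp
  moreover obtain v where "E_mat G x0 y0 z0 *v v = \<xi>" using E_mat_surj by blast
  ultimately show "\<xi> = 0" by (metis inner_eq_zero_iff)
qed

text \<open>For a vector (v, r) of the kernel, the component from G forces r = Q \<bullet> v; the
  component from G_x is then E v, so v vanishes.\<close>

lemma inj_dir_deriv_fY: "inj (\<lambda>u. dir_deriv u fY (y0, z0))"
proof (subst linear_injective_0, safe)
  show "linear (\<lambda>u. dir_deriv u fY (y0, z0))"
    by (rule linear_dir_deriv[OF smooth_on_differentiable[OF slice_Y(2)]]) (use w0 in simp)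
  fix v r assume "dir_deriv (v, r) fY (y0, z0) = 0"
  then have PF: "dir_deriv (0, v, r) P (x0, y0, z0) = 0" "dir_deriv (0, v, r) F (x0, y0, z0) = 0"
    by (simp_all add: dir_deriv_fY zero_prod_def)
  have r: "r = Q_map G x0 y0 z0 \<bullet> v" using PF(2) dir_deriv_F_snd[OF w0] N_neg[OF w0] by simp
  then have "E_mat G x0 y0 z0 *v v = 0" using PF(1) E_mat_mult[OF w0] by simp
  then have "v = 0" by (rule E_mat_eq_0)
  then show "(v, r) = 0" using r by (simp add: zero_prod_def)
qed

text \<open>The p-derivatives keep \<open>u\<close> fixed, hence the slice \<open>?S\<close> and the
  curve through \<open>(p + t *\<^sub>R \<eta>, u)\<close>. The quadratic form of A at \<xi> is an
  iterated x-derivative of G by \<open>Gxx_quadratic\<close>.\<close>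

lemma form_A_eq:
  assumes W: "open W" "(p, u) \<in> W" "smooth_on (YZ_loc G U I J x0 u p) W"
    and dom: "\<And>w. w \<in> W \<Longrightarrow> YZ_loc G U I J x0 u p w \<in> {(y, z). (x0, y) \<in> U \<and> z \<in> I}"
  shows "form_A G U I J x0 u p \<xi> \<eta> = dir_deriv 1 (dir_deriv 1
    (\<lambda>t. dir_deriv (\<xi>, 0, 0) (dir_deriv (\<xi>, 0, 0) F) (x0, YZ_loc G U I J x0 u p (p + t *\<^sub>R \<eta>, u)))) 0"
proof -
  let ?g = "YZ_loc G U I J x0 u p" and ?S = "{p'. (p', u) \<in> W}"
  have S: "open ?S" by (rule open_slices[OF W(1)])
  have gS: "smooth_on (\<lambda>p'. (x0, ?g (p', u))) ?S"
    by (intro smooth_on_Pair smooth_on_const S smooth_on_fst_slice[OF W(1,3)])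
  have g\<Omega>: "(x0, ?g (p', u)) \<in> \<Omega>" if "p' \<in> ?S" for p' using dom[of "(p', u)"] that by auto
  have sm: "smooth_on (\<lambda>p'. A_mat G U I J x0 u p p' $ i $ j) ?S" for i j
  proof (rule smooth_on_cong[OF S smooth_on_compose[OF smooth_on_dir_deriv[OF smooth_on_dir_deriv[OF smooth_G]] gS S]])
    show "dir_deriv (axis j 1, 0, 0) (dir_deriv (axis i 1, 0, 0) F) (x0, ?g (p', u)) = A_mat G U I J x0 u p p' $ i $ j"
      if "p' \<in> ?S" for p'
      using Gxx_nth g\<Omega>[OF that] by (cases "?g (p', u)") (simp add: A_mat_def)
  qed (rule image_subsetI, erule g\<Omega>)
  let ?T = "{t. p + t *\<^sub>R \<eta> \<in> ?S}"
  have "continuous_on UNIV (\<lambda>t. p + t *\<^sub>R \<eta>)" by (intro continuous_intros)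
  from open_vimage[OF S this] have T: "open ?T" by (simp add: vimage_def)
  have c: "smooth_on (\<lambda>t. p + t *\<^sub>R \<eta>) ?T"
    by (intro smooth_on_add smooth_on_const smooth_on_scaleR smooth_on_linear bounded_linear_ident T)
  have "form_A G U I J x0 u p \<xi> \<eta> = dir_deriv 1 (dir_deriv 1
      (\<lambda>t. \<Sum>i\<in>UNIV. \<Sum>j\<in>UNIV. \<xi> $ i * (\<xi> $ j * A_mat G U I J x0 u p (p + t *\<^sub>R \<eta>) $ i $ j))) 0"
    unfolding form_A_def by (rule quadratic_form_pd2[OF S sm]) (use W in simp)
  also have "\<dots> = dir_deriv 1 (dir_deriv 1
    (\<lambda>t. dir_deriv (\<xi>, 0, 0) (dir_deriv (\<xi>, 0, 0) F) (x0, ?g (p + t *\<^sub>R \<eta>, u)))) 0"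
  proof (rule dir_deriv2_cong[OF T])
    show "smooth_on (\<lambda>t. \<Sum>i\<in>UNIV. \<Sum>j\<in>UNIV. \<xi> $ i * (\<xi> $ j * A_mat G U I J x0 u p (p + t *\<^sub>R \<eta>) $ i $ j)) ?T"
      by (intro smooth_on_sum smooth_on_mult smooth_on_const T smooth_on_compose[OF sm c]) auto
    show "(\<Sum>i\<in>UNIV. \<Sum>j\<in>UNIV. \<xi> $ i * (\<xi> $ j * A_mat G U I J x0 u p (p + t *\<^sub>R \<eta>) $ i $ j))
        = dir_deriv (\<xi>, 0, 0) (dir_deriv (\<xi>, 0, 0) F) (x0, ?g (p + t *\<^sub>R \<eta>, u))" if "t \<in> ?T" for t
    proof -
      obtain y z where yz: "?g (p + t *\<^sub>R \<eta>, u) = (y, z)" by force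
      with g\<Omega>[of "p + t *\<^sub>R \<eta>"] that have "(x0, y, z) \<in> \<Omega>" by auto
      from Gxx_quadratic[OF this, of \<xi>] show ?thesis by (simp add: A_mat_def yz)
    qed
  qed (use W in simp)
  finally show ?thesis .
qed

lemma form_A_star_eq:
  assumes W: "open W" "q \<in> W" "smooth_on (X_loc G U J y0 z0 q) W"
    and dom: "\<And>q'. q' \<in> W \<Longrightarrow> X_loc G U J y0 z0 q q' \<in> {x. (x, y0) \<in> U}"
  shows "form_A_star G U J y0 z0 q \<xi> v = dir_deriv 1 (dir_deriv 1
    (\<lambda>s. dir_deriv (0, v, (q + s *\<^sub>R \<xi>) \<bullet> v) Q (X_loc G U J y0 z0 q (q + s *\<^sub>R \<xi>), y0, z0) \<bullet> v)) 0"
proof -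
  let ?X = "X_loc G U J y0 z0 q" and ?A = "A_star G U J y0 z0 q"
  have XS: "smooth_on (\<lambda>q'. (?X q', y0, z0)) W" by (intro smooth_on_Pair smooth_on_const W)
  have X\<Omega>: "(?X q', y0, z0) \<in> \<Omega>" if "q' \<in> W" for q' using dom[OF that] w0 by simp
  have sm: "smooth_on (\<lambda>q'. ?A q' $ k $ l) W" for k l
  proof (rule smooth_on_cong[OF W(1)])
    have D: "smooth_on (\<lambda>q'. dir_deriv u (\<lambda>w. Q w $ k) (?X q', y0, z0)) W" for u
      by (rule smooth_on_compose[OF smooth_on_dir_deriv[OF smooth_on_vec_nth[OF open_\<Omega> smooth_Q]] XS W(1)]) (use X\<Omega> in auto)
    show "smooth_on (\<lambda>q'. dir_deriv (0, axis l 1, 0) (\<lambda>w. Q w $ k) (?X q', y0, z0)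
        + dir_deriv (0, 0, 1) (\<lambda>w. Q w $ k) (?X q', y0, z0) * q' $ l) W"
      by (intro smooth_on_add smooth_on_mult W(1) D smooth_on_linear[OF _ bounded_linear_vec_nth])
  qed (rule A_star_nth[OF X\<Omega>, symmetric])
  let ?T = "{s. q + s *\<^sub>R \<xi> \<in> W}"
  have "continuous_on UNIV (\<lambda>t. q + t *\<^sub>R \<xi>)" by (intro continuous_intros)
  from open_vimage[OF W(1) this] have T: "open ?T" by (simp add: vimage_def)
  have c: "smooth_on (\<lambda>t. q + t *\<^sub>R \<xi>) ?T"
    by (intro smooth_on_add smooth_on_const smooth_on_scaleR smooth_on_linear bounded_linear_ident T)
  \<comment> \<open>In \<open>form_A_star\<close> the outer two indices belong to the
    differentiation and the inner two to the matrix entries, the reverse of \<open>form_A\<close>;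
    the sums are swapped to fit \<open>quadratic_form_pd2\<close>.\<close>
  have "form_A_star G U J y0 z0 q \<xi> v = (\<Sum>k\<in>UNIV. \<Sum>l\<in>UNIV. \<Sum>i\<in>UNIV. \<Sum>j\<in>UNIV.
      pd2 i j (\<lambda>q'. ?A q' $ k $ l) q * v $ k * v $ l * \<xi> $ i * \<xi> $ j)"
    unfolding form_A_star_def by (subst sum_swap_pairs) (simp add: mult_ac)
  also have "\<dots> = dir_deriv 1 (dir_deriv 1
      (\<lambda>s. \<Sum>k\<in>UNIV. \<Sum>l\<in>UNIV. v $ k * (v $ l * ?A (q + s *\<^sub>R \<xi>) $ k $ l))) 0"
    by (rule quadratic_form_pd2[OF W(1) sm W(2)])
  also have "\<dots> = dir_deriv 1 (dir_deriv 1
    (\<lambda>s. dir_deriv (0, v, (q + s *\<^sub>R \<xi>) \<bullet> v) Q (?X (q + s *\<^sub>R \<xi>), y0, z0) \<bullet> v)) 0"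
  proof (rule dir_deriv2_cong[OF T])
    show "smooth_on (\<lambda>s. \<Sum>k\<in>UNIV. \<Sum>l\<in>UNIV. v $ k * (v $ l * ?A (q + s *\<^sub>R \<xi>) $ k $ l)) ?T"
      by (intro smooth_on_sum smooth_on_mult smooth_on_const T smooth_on_compose[OF sm c]) auto
    show "(\<Sum>k\<in>UNIV. \<Sum>l\<in>UNIV. v $ k * (v $ l * ?A (q + s *\<^sub>R \<xi>) $ k $ l))
        = dir_deriv (0, v, (q + s *\<^sub>R \<xi>) \<bullet> v) Q (?X (q + s *\<^sub>R \<xi>), y0, z0) \<bullet> v" if "s \<in> ?T" for s
      using A_star_quadratic[OF X\<Omega>] that by blast
  qed (use W in simp)
  finally show ?thesis .
qed

text \<open>Both sides are evaluations of the same a''(0): \<open>mixed_fourth_derivative\<close>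
  leads to the form of A, while \<open>second_derivative_fibre_curve\<close> and
  \<open>product_second_derivative\<close> lead to that of the dual matrix. \<open>X0\<close> and
  \<open>YZ0\<close> base the local inverses at the given point.\<close>

lemma forms_proportional:
  fixes \<xi> v :: "real ^ 'n"
  assumes X0: "X_map G U J y0 z0 (Q_map G x0 y0 z0) = x0"
    and YZ0: "YZ G U J x0 (G x0 y0 z0) (Gx G x0 y0 z0) = (y0, z0)"
    and orth: "\<xi> \<bullet> (E_mat G x0 y0 z0 *v v) = 0"
  shows "form_A G U I J x0 (G x0 y0 z0) (Gx G x0 y0 z0) \<xi> (E_mat G x0 y0 z0 *v v) =
    - Gz G x0 y0 z0 * form_A_star G U J y0 z0 (Q_map G x0 y0 z0) (dir_deriv (\<xi>, 0, 0) Q (x0, y0, z0)) v"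
proof -
  define \<eta> where "\<eta> = E_mat G x0 y0 z0 *v v"
  define p where "p = Gx G x0 y0 z0"
  define u where "u = G x0 y0 z0"
  define q where "q = Q_map G x0 y0 z0"
  define \<zeta> where "\<zeta> = dir_deriv (\<xi>, 0, 0) Q (x0, y0, z0)"
  define X where "X = X_loc G U J y0 z0 q"
  define Y where "Y = YZ_loc G U I J x0 u p"
  have \<zeta>v: "\<zeta> \<bullet> v = 0" using orth E_mat_dual[OF w0] N_neg[OF w0] by (simp add: \<zeta>_def)
  have Xdef: "X = local_inverse fX {x. (x, y0) \<in> U} x0" by (simp add: X_def X_loc_def q_def X0)
  have Ydef: "Y = local_inverse fY {(y, z). (x0, y) \<in> U \<and> z \<in> I} (y0, z0)" by (simp add: Y_def YZ_loc_def u_def p_def YZ0)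
  have mem: "x0 \<in> {x. (x, y0) \<in> U}" "(y0, z0) \<in> {(y, z). (x0, y) \<in> U \<and> z \<in> I}" using w0 by auto
  obtain WX where WX: "open WX" "q \<in> WX" "smooth_on X WX" "X q = x0"
    "\<And>q'. q' \<in> WX \<Longrightarrow> X q' \<in> {x. (x, y0) \<in> U}" "\<And>q'. q' \<in> WX \<Longrightarrow> Q_map G (X q') y0 z0 = q'"
    using smooth_local_inverse[OF slice_X mem(1) inj_dir_deriv_fX] unfolding Xdef q_def by metis
  have fYp: "fY (y0, z0) = (p, u)" by (simp add: p_def u_def)
  obtain WY where WY: "open WY" "(p, u) \<in> WY" "smooth_on Y WY" "Y (p, u) = (y0, z0)"
    "\<And>w. w \<in> WY \<Longrightarrow> Y w \<in> {(y, z). (x0, y) \<in> U \<and> z \<in> I}" "\<And>w. w \<in> WY \<Longrightarrow> fY (Y w) = w"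
    using smooth_local_inverse[OF slice_Y mem(2) inj_dir_deriv_fY, folded Ydef, unfolded fYp] by blast
  \<comment> \<open>Q moves on a straight line of direction \<zeta> along the first curve, and the
    pair (G_x, G) on one of direction (\<eta>, 0) along the second.\<close>
  define x where "x s = X (q + s *\<^sub>R \<zeta>)" for s :: real
  define yz where "yz t = Y (p + t *\<^sub>R \<eta>, u)" for t :: real
  define TX where "TX = {s. q + s *\<^sub>R \<zeta> \<in> WX}"
  define TY where "TY = {t. (p + t *\<^sub>R \<eta>, u) \<in> WY}"
  have "continuous_on UNIV (\<lambda>s. q + s *\<^sub>R \<zeta>)" "continuous_on UNIV (\<lambda>t. (p + t *\<^sub>R \<eta>, u))"
    by (intro continuous_intros)+
  then have TX: "open TX" and TY: "open TY"
    using open_vimage[OF WX(1)] open_vimage[OF WY(1)] by (auto simp: TX_def TY_def vimage_def)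
  have x_smooth: "smooth_on x TX"
    unfolding x_def
    by (rule smooth_on_compose[OF WX(3)]; (intro smooth_on_add smooth_on_const smooth_on_scaleR smooth_on_linear bounded_linear_ident TX)?)
      (auto simp: TX_def)
  have yz_smooth: "smooth_on yz TY"
    unfolding yz_def
    by (rule smooth_on_compose[OF WY(3)]; (intro smooth_on_Pair smooth_on_add smooth_on_const smooth_on_scaleR smooth_on_linear bounded_linear_ident TY)?)
      (auto simp: TY_def)
  have x0: "x 0 = x0" and yz0: "yz 0 = (y0, z0)" using WX(4) WY(4) by (simp_all add: x_def yz_def)
  have "0 \<in> TX" "0 \<in> TY" using WX(2) WY(2) by (simp_all add: TX_def TY_def)
  \<comment> \<open>A common parameter set such that G is defined at every pair of points of the two
    curves; the interchange of s- and t-derivatives needs the full product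
    \<open>T \<times> T\<close>.\<close>
  obtain T where T: "open T" "0 \<in> T" "T \<subseteq> TX" "T \<subseteq> TY" "\<And>s t. s \<in> T \<Longrightarrow> t \<in> T \<Longrightarrow> (x s, yz t) \<in> \<Omega>"
  proof -
    have "continuous_on (TX \<times> TY) (\<lambda>w. (x (fst w), yz (snd w)))"
      by (intro continuous_on_Pair continuous_on_compose2[OF smooth_on_imp_continuous_on[OF x_smooth]]
          continuous_on_compose2[OF smooth_on_imp_continuous_on[OF yz_smooth]] continuous_intros) auto
    then have "open ((TX \<times> TY) \<inter> (\<lambda>w. (x (fst w), yz (snd w))) -` \<Omega>)"
      by (rule continuous_open_preimage[OF _ open_Times[OF TX TY] open_\<Omega>])
    moreover have "(0, 0) \<in> (TX \<times> TY) \<inter> (\<lambda>w. (x (fst w), yz (snd w))) -` \<Omega>"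
      using w0 x0 yz0 \<open>0 \<in> TX\<close> \<open>0 \<in> TY\<close> by simp
    ultimately obtain A B where AB: "open A" "open B" "(0, 0) \<in> A \<times> B"
      "A \<times> B \<subseteq> (TX \<times> TY) \<inter> (\<lambda>w. (x (fst w), yz (snd w))) -` \<Omega>"
      by (rule open_prod_elim)
    show thesis
    proof (rule that[of "A \<inter> B"])
      show "(x s, yz t) \<in> \<Omega>" if "s \<in> A \<inter> B" "t \<in> A \<inter> B" for s t
      proof -
        have "(s, t) \<in> A \<times> B" using that by blast
        then have "(s, t) \<in> (\<lambda>w. (x (fst w), yz (snd w))) -` \<Omega>" using AB(4) by blast
        then show ?thesis by simp
      qed
    qed (use AB in auto)
  qed
  have x_T: "smooth_on x T" and yz_T: "smooth_on yz T" using x_smooth yz_smooth T smooth_on_subset by blast+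
  have Qx: "Q_map G (x s) y0 z0 = q + s *\<^sub>R \<zeta>" if "s \<in> T" for s
    using WX(6) that T(3) by (auto simp: x_def TX_def)
  have fYyz: "fY (yz t) = (p + t *\<^sub>R \<eta>, u)" if "t \<in> T" for t
    using WY(6) that T(4) unfolding yz_def TY_def by blast
  have Fyz: "F (x0, yz t) = u" and Pyz: "P (x0, yz t) = p + t *\<^sub>R \<eta>" if "t \<in> T" for t
    using fYyz[OF that] by (cases "yz t"; simp)+
  \<comment> \<open>Q along \<open>x\<close> has velocity \<zeta>, the image of \<xi> under the
    derivative of \<open>fX\<close>, so injectivity identifies the velocity of
    \<open>x\<close>.\<close>
  have x1: "dir_deriv 1 x 0 = \<xi>"
  proof -
    have "dir_deriv (dir_deriv 1 x 0) fX x0 = dir_deriv 1 (\<lambda>s. fX (x s)) 0"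
      using dir_deriv_curve[of x 0 fX] smooth_on_differentiable[OF x_T T(2)] smooth_on_differentiable[OF slice_X(2) mem(1)]
      by (simp add: x0)
    also have "\<dots> = dir_deriv 1 (\<lambda>s. q + s *\<^sub>R \<zeta>) 0"
      by (rule dir_deriv_cong[OF T(1,2), symmetric]) (auto simp: Qx intro!: derivative_intros)
    also have "\<dots> = dir_deriv \<xi> fX x0" by (simp add: dir_deriv_affine dir_deriv_fX \<zeta>_def)
    finally show ?thesis using injD[OF inj_dir_deriv_fX] by blast
  qed
  \<comment> \<open>The candidate velocity is the level direction over \<open>v\<close>: the
    derivative of \<open>fY\<close> sends it to (E v, 0), which is (\<eta>, 0).\<close>
  have yz1: "dir_deriv 1 yz 0 = (v, q \<bullet> v)"
  proof -
    have "dir_deriv (dir_deriv 1 yz 0) fY (y0, z0) = dir_deriv 1 (\<lambda>t. fY (yz t)) 0"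
      using dir_deriv_curve[of yz 0 fY] smooth_on_differentiable[OF yz_T T(2)] smooth_on_differentiable[OF slice_Y(2) mem(2)]
      by (simp add: yz0)
    also have "\<dots> = dir_deriv 1 (\<lambda>t. (p, u) + t *\<^sub>R (\<eta>, 0)) 0"
      by (rule dir_deriv_cong[OF T(1,2), symmetric]) (auto simp: fYyz intro!: derivative_intros)
    also have "\<dots> = (\<eta>, 0)" by (rule trans[OF dir_deriv_affine]) simp
    also have "\<dots> = dir_deriv (v, q \<bullet> v) fY (y0, z0)"
      using dir_deriv_F_snd[OF w0, of v "q \<bullet> v"] by (simp add: dir_deriv_fY \<eta>_def E_mat_mult[OF w0] q_def)
    finally show ?thesis using injD[OF inj_dir_deriv_fY] by blast
  qed
  define y where "y t = fst (yz t)" for t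
  define z where "z t = snd (yz t)" for t
  have yz_eq: "yz t = (y t, z t)" for t by (simp add: y_def z_def)
  have y_T: "smooth_on y T" and z_T: "smooth_on z T"
    unfolding y_def z_def by (intro smooth_on_linear_comp[OF _ T(1) yz_T] bounded_linear_fst bounded_linear_snd)+
  have y1: "dir_deriv 1 y 0 = v" and z1: "dir_deriv 1 z 0 = q \<bullet> v"
    unfolding y_def z_def
    using dir_deriv_linear_comp[OF bounded_linear_fst smooth_on_differentiable[OF yz_T T(2)], of 1]
      dir_deriv_linear_comp[OF bounded_linear_snd smooth_on_differentiable[OF yz_T T(2)], of 1] yz1 by simp_all
  have y0: "y 0 = y0" and z0: "z 0 = z0" using yz0 by (simp_all add: y_def z_def)
  define a where "a = (\<lambda>s. dir_deriv 1 (dir_deriv 1 (\<lambda>t. F (x s, yz t))) 0)"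
  have a: "a 0 = 0" "dir_deriv 1 a 0 = 0"
    "dir_deriv 1 (dir_deriv 1 a) 0 = dir_deriv 1 (dir_deriv 1
       (\<lambda>t. dir_deriv (\<xi>, 0) (dir_deriv (\<xi>, 0) F) (x0, yz t))) 0"
  proof -
    have "F (x 0, yz t) = u" if "t \<in> T" for t using Fyz[OF that] x0 by simp
    moreover have "dir_deriv (v, 0) F (x 0, yz t) = (p + t *\<^sub>R \<eta>) \<bullet> v" if "t \<in> T" for t v
      using dir_deriv_F_fst[OF T(5)[OF T(2) that], of v] Pyz[OF that] x0 by (simp add: zero_prod_def)
    moreover have "dir_deriv 1 x 0 \<bullet> \<eta> = 0" using orth x1 by (simp add: \<eta>_def)
    ultimately show "a 0 = 0" "dir_deriv 1 a 0 = 0"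
      "dir_deriv 1 (dir_deriv 1 a) 0 = dir_deriv 1 (dir_deriv 1
       (\<lambda>t. dir_deriv (\<xi>, 0) (dir_deriv (\<xi>, 0) F) (x0, yz t))) 0"
      using mixed_fourth_derivative[OF open_\<Omega> smooth_G T(1,2) x_T yz_T T(5), of u p \<eta>] x0 x1
      unfolding a_def by blast+
  qed
  \<comment> \<open>The quadratic form of the dual matrix at \<open>v\<close> along
    \<open>q + s *\<^sub>R \<zeta>\<close>. Writing \<open>q \<bullet> v\<close> for
    \<open>(q + s *\<^sub>R \<zeta>) \<bullet> v\<close> is legitimate because \<zeta> \<bullet> v =
    0.\<close>
  define k where "k s = dir_deriv (0, v, q \<bullet> v) Q (x s, y0, z0) \<bullet> v" for s
  \<comment> \<open>The bracket from \<open>second_derivative_fibre_curve\<close> at x(s). Apart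
    from \<open>k\<close> it is affine in \<open>s\<close>: Q(x(s)) is affine, and the accelerations
    of \<open>y\<close> and \<open>z\<close> at 0 do not depend on \<open>s\<close>.\<close>
  define b where "b s = (dir_deriv 1 (dir_deriv 1 z) 0 - q \<bullet> dir_deriv 1 (dir_deriv 1 y) 0)
      + s *\<^sub>R (- (\<zeta> \<bullet> dir_deriv 1 (dir_deriv 1 y) 0)) - k s" for s :: real
  have xw: "smooth_on (\<lambda>s. (x s, y0, z0)) T" by (intro smooth_on_Pair smooth_on_const x_T T)
  have xw\<Omega>: "(x s, y0, z0) \<in> \<Omega>" if "s \<in> T" for s using T(5)[OF that T(2)] yz0 by simp
  have k_smooth: "smooth_on k T"
    unfolding k_def
    by (intro smooth_on_inner smooth_on_const T(1) smooth_on_compose[OF smooth_on_dir_deriv[OF smooth_Q] xw]) (use xw\<Omega> in auto)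
  have l_smooth: "smooth_on (\<lambda>s. (dir_deriv 1 (dir_deriv 1 z) 0 - q \<bullet> dir_deriv 1 (dir_deriv 1 y) 0)
      + s *\<^sub>R (- (\<zeta> \<bullet> dir_deriv 1 (dir_deriv 1 y) 0))) T" (is "smooth_on ?l T")
    by (intro smooth_on_add smooth_on_const smooth_on_scaleR smooth_on_linear bounded_linear_ident T(1))
  have b_smooth: "smooth_on b T"
    using smooth_on_add[OF T(1) l_smooth smooth_on_minus[OF T(1) k_smooth]] by (simp add: b_def[abs_def])
  have c_smooth: "smooth_on (\<lambda>s. Gz G (x s) y0 z0) T"
    using smooth_on_compose[OF smooth_N xw T(1)] xw\<Omega> by (simp add: image_subset_iff)
  have ab: "a s = Gz G (x s) y0 z0 * b s" if "s \<in> T" for s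
  proof -
    \<comment> \<open>Orthogonality of \<zeta> and \<open>v\<close> makes the curve tangent to the
      level set of G(x(s), ., .) for every \<open>s\<close> in \<open>T\<close>, not only for
      \<open>s = 0\<close>.\<close>
    have "dir_deriv 1 z 0 = Q (x s, y 0, z 0) \<bullet> dir_deriv 1 y 0"
      using Qx[OF that] \<zeta>v by (simp add: y0 z0 y1 z1 inner_add_left)
    from second_derivative_fibre_curve[OF open_\<Omega> smooth_G smooth_N smooth_Q T(1,2) y_T z_T _ dir_deriv_F_snd this]
    show ?thesis
      using T(5)[OF that] Qx[OF that] by (simp add: a_def b_def k_def yz_eq y0 z0 y1 z1 algebra_simps)
  qed
  have b2: "dir_deriv 1 (dir_deriv 1 b) 0 = - dir_deriv 1 (dir_deriv 1 k) 0"
  proof -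
    note kd = smooth_on_differentiable[OF k_smooth] and ld = smooth_on_differentiable[OF l_smooth]
    have "dir_deriv 1 (dir_deriv 1 b) 0 = dir_deriv 1 (\<lambda>s. - (\<zeta> \<bullet> dir_deriv 1 (dir_deriv 1 y) 0) - dir_deriv 1 k s) 0"
    proof (rule dir_deriv_cong[OF T(1,2) smooth_on_differentiable[OF smooth_on_dir_deriv[OF b_smooth] T(2)]])
      show "dir_deriv 1 b s = - (\<zeta> \<bullet> dir_deriv 1 (dir_deriv 1 y) 0) - dir_deriv 1 k s" if "s \<in> T" for s
        unfolding b_def dir_deriv_diff[OF ld[OF that] kd[OF that]] dir_deriv_affine by simp
    qed
    also have "\<dots> = - dir_deriv 1 (dir_deriv 1 k) 0"
      using dir_deriv_diff[OF differentiable_const smooth_on_differentiable[OF smooth_on_dir_deriv[OF k_smooth] T(2)]] by simp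
    finally show ?thesis .
  qed
  have "form_A G U I J x0 u p \<xi> \<eta> = dir_deriv 1 (dir_deriv 1 a) 0"
    unfolding a(3) using form_A_eq[OF WY(1,2), of J \<xi> \<eta>] WY(3,5) by (simp add: Y_def yz_def zero_prod_def)
  also have "\<dots> = Gz G x0 y0 z0 * dir_deriv 1 (dir_deriv 1 b) 0"
    using product_second_derivative[OF T(1,2) b_smooth c_smooth ab _ a(1,2)] N_neg[OF w0] by (simp add: x0)
  also have "dir_deriv 1 (dir_deriv 1 k) 0 = form_A_star G U J y0 z0 q \<zeta> v"
    using form_A_star_eq[OF WX(1,2), of J \<zeta> v] WX(3,5) \<zeta>v
    by (simp add: X_def x_def k_def[abs_def] inner_add_left)
  then have "dir_deriv 1 (dir_deriv 1 b) 0 = - form_A_star G U J y0 z0 q \<zeta> v" by (simp add: b2)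
  finally show ?thesis by (simp add: \<eta>_def p_def u_def q_def \<zeta>_def)
qed

end


section \<open>From the points of \<Gamma> to the equivalence of the conditions\<close>

lemma Gamma_set_point:
  assumes G1: "cond_G1 G U I J" and G2: "cond_G2 G U J" and G1': "cond_G1_star G U J"
    and w: "(x, y, z) \<in> Gamma_set U J"
  shows "(x, y, z) \<in> \<Omega>" "det (E_mat G x y z) \<noteq> 0" "X_map G U J y z (Q_map G x y z) = x"
    "YZ G U J x (G x y z) (Gx G x y z) = (y, z)"
proof -
  have U: "(x, y) \<in> U" "z \<in> J x y" using w by (auto simp: Gamma_set_def)
  then show "(x, y, z) \<in> \<Omega>" using G1 by (auto simp: cond_G1_def)
  show "det (E_mat G x y z) \<noteq> 0" using G2 w by (auto simp: cond_G2_def)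
  have "y \<in> proj2 U" using U by (auto simp: proj2_def fibre2_def)
  \<comment> \<open>Injectivity from G1* makes the \<open>THE\<close> in \<open>X_map\<close> return
    \<open>x\<close>; injectivity from G1 does the same for \<open>YZ\<close> below.\<close>
  then have "inj_on (\<lambda>x. Q_map G x y z) {x. (x, y, z) \<in> Gamma_set U J}" using G1' by (auto simp: cond_G1_star_def)
  then show "X_map G U J y z (Q_map G x y z) = x"
    unfolding X_map_def using w by (intro the_equality) (auto dest: inj_onD)
  have "x \<in> proj1 U" using U by (auto simp: proj1_def)
  then have inj: "inj_on (\<lambda>(y, z). (Gx G x y z, G x y z)) {(y, z). y \<in> fibre2 U x \<and> z \<in> J x y}"
    using G1 by (auto simp: cond_G1_def)
  show "YZ G U J x (G x y z) (Gx G x y z) = (y, z)"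
    unfolding YZ_def
  proof (rule the_equality)
    fix yz assume "case yz of (y', z') \<Rightarrow>
      (x, y', z') \<in> Gamma_set U J \<and> Gx G x y' z' = Gx G x y z \<and> G x y' z' = G x y z"
    then show "yz = (y, z)"
      using inj_onD[OF inj, of yz "(y, z)"] U by (auto simp: Gamma_set_def fibre2_def)
  qed (use w in simp)
qed

text \<open>\<open>R\<close> is "positive" or "nonnegative". The forms differ by the positive factor
  - G_z, so invariance of \<open>R\<close> under positive scaling treats the strict and the weak
  case together. What remains is that every pair of nonzero orthogonal vectors on either side comes
  from one on the other.\<close>

lemma sign_condition_dual:
  assumes G1: "cond_G1 G U I J" and G2: "cond_G2 G U J" and G1': "cond_G1_star G U J"
    and R: "\<And>c a :: real. c > 0 \<Longrightarrow> R (c * a) \<longleftrightarrow> R a"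
  shows "(\<forall>(x, u, p)\<in>Gamma' G U J. \<forall>\<xi> \<eta>. \<xi> \<noteq> 0 \<longrightarrow> \<eta> \<noteq> 0 \<longrightarrow> \<xi> \<bullet> \<eta> = 0 \<longrightarrow> R (form_A G U I J x u p \<xi> \<eta>)) \<longleftrightarrow>
    (\<forall>(y, z, q)\<in>dom_A_star G U J. \<forall>\<xi> \<eta>. \<xi> \<noteq> 0 \<longrightarrow> \<eta> \<noteq> 0 \<longrightarrow> \<xi> \<bullet> \<eta> = 0 \<longrightarrow> R (form_A_star G U J y z q \<xi> \<eta>))"
    (is "?lhs \<longleftrightarrow> ?rhs")
proof
  assume L: ?lhs
  show ?rhs
  proof (clarify)
    fix y q \<zeta> v :: "real ^ 'n" and z :: real
    assume "(y, z, q) \<in> dom_A_star G U J" and nz: "\<zeta> \<noteq> 0" "v \<noteq> 0" and orth: "\<zeta> \<bullet> v = 0"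
    then obtain x where w: "(x, y, z) \<in> Gamma_set U J" and q: "q = Q_map G x y z" by (auto simp: dom_A_star_def)
    note pt = Gamma_set_point[OF G1 G2 G1' w]
    \<comment> \<open>The x-derivative of Q is an injective linear map of the space to itself, hence
      surjective.\<close>
    obtain \<xi> where \<xi>: "dir_deriv (\<xi>, 0, 0) Q (x, y, z) = \<zeta>"
    proof -
      have lin: "linear (\<lambda>\<xi>. dir_deriv \<xi> (\<lambda>x. Q_map G x y z) x)"
        by (rule linear_dir_deriv[OF smooth_on_differentiable[OF slice_X(2)[OF pt(1,2)]]]) (use pt(1) in simp)
      show thesis
        using linear_injective_imp_surjective[OF lin inj_dir_deriv_fX[OF pt(1,2)]] that
        unfolding dir_deriv_fX[OF pt(1,2)] surj_def by metis
    qed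
    have "\<xi> \<noteq> 0"
      using nz(1) \<xi> linear_0[OF linear_dir_deriv[OF smooth_on_differentiable[OF smooth_Q pt(1)]]] by (auto simp: zero_prod_def)
    moreover have "E_mat G x y z *v v \<noteq> 0" using E_mat_eq_0[OF pt(1,2)] nz(2) by blast
    moreover have o: "\<xi> \<bullet> (E_mat G x y z *v v) = 0" using E_mat_dual[OF pt(1)] \<xi> orth by simp
    moreover have "(x, G x y z, Gx G x y z) \<in> Gamma' G U J" using w by (auto simp: Gamma'_def)
    ultimately have "R (form_A G U I J x (G x y z) (Gx G x y z) \<xi> (E_mat G x y z *v v))" using L by blast
    then show "R (form_A_star G U J y z q \<zeta> v)"
      using forms_proportional[OF pt o] R[of "- Gz G x y z"] N_neg[OF pt(1)] by (simp add: \<xi> q)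
  qed
next
  assume L: ?rhs
  show ?lhs
  proof (clarify)
    fix x p \<xi> \<eta> :: "real ^ 'n" and u :: real
    assume "(x, u, p) \<in> Gamma' G U J" and nz: "\<xi> \<noteq> 0" "\<eta> \<noteq> 0" and orth: "\<xi> \<bullet> \<eta> = 0"
    then obtain y z where w: "(x, y, z) \<in> Gamma_set U J" and up: "u = G x y z" "p = Gx G x y z"
      by (auto simp: Gamma'_def)
    note pt = Gamma_set_point[OF G1 G2 G1' w]
    obtain v where v: "E_mat G x y z *v v = \<eta>" using E_mat_surj[OF pt(1,2)] by blast
    let ?\<zeta> = "dir_deriv (\<xi>, 0, 0) Q (x, y, z)"
    have o: "\<xi> \<bullet> (E_mat G x y z *v v) = 0" using orth v by simp
    \<comment> \<open>Otherwise \<open>E_mat_dual\<close> makes \<xi> orthogonal to the range of E,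
      and so to itself.\<close>
    have "?\<zeta> \<noteq> 0"
    proof
      assume "?\<zeta> = 0"
      then have "\<xi> \<bullet> (E_mat G x y z *v v') = 0" for v' using E_mat_dual[OF pt(1)] by simp
      moreover obtain v' where "E_mat G x y z *v v' = \<xi>" using E_mat_surj[OF pt(1,2)] by blast
      ultimately show False using nz(1) by (metis inner_eq_zero_iff)
    qed
    moreover have "v \<noteq> 0" using v nz(2) by auto
    moreover have "?\<zeta> \<bullet> v = 0" using E_mat_dual[OF pt(1), of \<xi> v] o N_neg[OF pt(1)] by simp
    moreover have "(y, z, Q_map G x y z) \<in> dom_A_star G U J" using w by (auto simp: dom_A_star_def)
    ultimately have "R (form_A_star G U J y z (Q_map G x y z) ?\<zeta> v)" using L by blast
    then show "R (form_A G U I J x u p \<xi> \<eta>)"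
      using forms_proportional[OF pt o] R[of "- Gz G x y z"] N_neg[OF pt(1)] by (simp add: v up)
  qed
qed

end

theorem theorem3p1:
  fixes U :: "((real ^ 'n) \<times> (real ^ 'n)) set"
    and I :: "real set"
    and G :: "real ^ 'n \<Rightarrow> real ^ 'n \<Rightarrow> real \<Rightarrow> real"
    and J :: "real ^ 'n \<Rightarrow> real ^ 'n \<Rightarrow> real set"
  assumes "open U"
    and "I = UNIV \<or> I = {0<..}"
    and "smooth_on (\<lambda>(x, y, z). G x y z) {(x, y, z). (x, y) \<in> U \<and> z \<in> I}"
    and "\<And>x y z. (x, y) \<in> U \<Longrightarrow> z \<in> I \<Longrightarrow> Gz G x y z < 0"
    and "cond_G1 G U I J"
    and "cond_G2 G U J"
    and "cond_G1_star G U J"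
  shows "(cond_G3 G U I J \<longleftrightarrow> cond_G3_star G U J) \<and>
         (cond_G3w G U I J \<longleftrightarrow> cond_G3w_star G U J)"
proof -
  \<comment> \<open>Both admissible intervals \<open>I\<close> are open, as the locale
    requires.\<close>
  interpret generating_function U I G
    by unfold_locales (use assms in auto)
  show ?thesis
    unfolding cond_G3_def cond_G3_star_def cond_G3w_def cond_G3w_star_def
    using sign_condition_dual[OF assms(5-7), of "\<lambda>a. a > 0"] sign_condition_dual[OF assms(5-7), of "\<lambda>a. a \<ge> 0"]
    by (simp add: zero_less_mult_iff zero_le_mult_iff)
qed

end
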